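(* Let $p$ and $q$ be two real numbers such that $2<p<q$, and consider the positive periodic solutions $w:\mathbb R\to(0,\infty)$ of $$\big(|w'|^{p-2}w'\big)'+|w|^{q-2}w-|w|^{p-2}w=0 .$$ Let $E_*=\frac1p-\frac1q$ and, for $E\in(0,E_* )$, let $T(E)$ be the minimal period of such a solution with energy $E$. Then the map $E\mapsto T(E)$ is increasing on $(0,E_* )$, with $$\lim_{E\to0_+}T(E)=0\quad\text{and}\quad\lim_{E\to(E_* )_-}T(E)=+\infty .$$
   Context: Let $p'=p/(p-1)$ and $\mathcal V(w)=\frac1q|w|^q-\frac1p|w|^p-\big(\frac1q-\frac1p\big)$, so that $\mathcal V(1)=\mathcal V'(1)=0$ and $\mathcal V(0)=E_*$. The energy of a solution is the conserved quantity $E=\frac1{p'}|w'|^p+\mathcal V(w)$. For $E\in(0,E_* )$ the positive periodic solution of energy $E$ is unique up to translations; it oscillates between the two positive roots $w_1(E)<1<w_2(E)$ of $\mathcal V(w)=E$, and its minimal period is $$T(E)=\frac{2}{(p')^{1/p}}\int_{w_1(E)}^{w_2(E)}\frac{dw}{(E-\mathcal V(w))^{1/p}}.$$ *)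

theory Defs
  imports "HOL-Analysis.Analysis"
begin

text \<open>The map \<open>x \<mapsto> |x|\<^sup>r\<^sup>-\<^sup>2 x\<close>. Since \<open>0 powr a = 0\<close>, it vanishes at \<open>0\<close>, as it should for \<open>r > 2\<close>.\<close>

definition signed_pow :: "real \<Rightarrow> real \<Rightarrow> real" where
  "signed_pow r x = \<bar>x\<bar> powr (r - 2) * x"

text \<open>Classical solutions of \<open>(|w'|\<^sup>p\<^sup>-\<^sup>2 w')' + |w|\<^sup>q\<^sup>-\<^sup>2 w - |w|\<^sup>p\<^sup>-\<^sup>2 w = 0\<close> on the whole line: only \<open>w\<close> and
  the flux \<open>|w'|\<^sup>p\<^sup>-\<^sup>2 w'\<close> are required to be differentiable. For \<open>p > 2\<close> the function \<open>w'\<close> itself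
  need not be differentiable where it vanishes; it is automatically continuous, because the
  flux is.\<close>

definition plaplace_solution :: "real \<Rightarrow> real \<Rightarrow> (real \<Rightarrow> real) \<Rightarrow> bool" where
  "plaplace_solution p q w \<longleftrightarrow>
     (\<forall>t. w differentiable at t) \<and>
     (\<forall>t. (\<lambda>s. signed_pow p (deriv w s)) differentiable at t) \<and>
     (\<forall>t. deriv (\<lambda>s. signed_pow p (deriv w s)) t + signed_pow q (w t) - signed_pow p (w t) = 0)"

definition potential :: "real \<Rightarrow> real \<Rightarrow> real \<Rightarrow> real" where
  "potential p q x = 1 / q * \<bar>x\<bar> powr q - 1 / p * \<bar>x\<bar> powr p - (1 / q - 1 / p)"

definition conjugate_exponent :: "real \<Rightarrow> real" where
  "conjugate_exponent p = p / (p - 1)"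

definition has_energy :: "real \<Rightarrow> real \<Rightarrow> (real \<Rightarrow> real) \<Rightarrow> real \<Rightarrow> bool" where
  "has_energy p q w E \<longleftrightarrow>
     (\<forall>t. 1 / conjugate_exponent p * \<bar>deriv w t\<bar> powr p + potential p q (w t) = E)"

definition is_period :: "(real \<Rightarrow> real) \<Rightarrow> real \<Rightarrow> bool" where
  "is_period w T \<longleftrightarrow> T > 0 \<and> (\<forall>t. w (t + T) = w t)"

definition is_minimal_period :: "(real \<Rightarrow> real) \<Rightarrow> real \<Rightarrow> bool" where
  "is_minimal_period w T \<longleftrightarrow> is_period w T \<and> (\<forall>S. is_period w S \<longrightarrow> T \<le> S)"

definition max_energy :: "real \<Rightarrow> real \<Rightarrow> real" where
  "max_energy p q = 1 / p - 1 / q"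

text \<open>For \<open>2 < p < q\<close> and \<open>0 < E < max_energy p q\<close> the positive periodic solution of energy \<open>E\<close>
  exists and is unique up to translations, so the description below is proper. Neither fact is
  part of the definition. For other values of \<open>E\<close> the value of \<open>period\<close> is irrelevant.\<close>

definition period :: "real \<Rightarrow> real \<Rightarrow> real \<Rightarrow> real" where
  "period p q E =
     (THE T. \<exists>w. plaplace_solution p q w \<and> (\<forall>t. w t > 0) \<and> has_energy p q w E \<and>
                 is_minimal_period w T)"

end

theory Submission
  imports Defs
begin

text \<open>On the orbit of energy \<open>E = r\<^sup>2\<close> write \<open>V(w) = r\<^sup>2 sin\<^sup>2 \<theta>\<close> and \<open>|w'|\<^sup>p / p' = r\<^sup>2 cos\<^sup>2 \<theta>\<close>. With \<open>g\<close> the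
  inverse of \<open>h = \<plusminus>sqrt V\<close> the time element becomes \<open>dt = k \<theta> d\<theta>\<close>, where \<open>k \<theta>\<close> is a constant times
  \<open>|r cos \<theta>|\<^sup>1\<^sup>-\<^sup>2\<^sup>/\<^sup>p g'(r sin \<theta>)\<close>, a continuous function since \<open>p > 2\<close>. Inverting its primitive gives a
  solution; conversely every solution of energy \<open>E\<close> lifts to an angle and is a translate of this one,
  so the period is the integral of \<open>k\<close> over a full turn.

  Monotonicity in \<open>E\<close> follows once \<open>y\<^sup>1\<^sup>-\<^sup>2\<^sup>/\<^sup>p (g'(y) + g'(-y))\<close> is increasing in \<open>y\<close>. Substituting
  \<open>z = w\<^sup>p\<^sup>/\<^sup>2\<close> turns \<open>V\<close> into a multiple of the potential \<open>v\<close> with exponents \<open>2\<close> and \<open>Q = 2q/p\<close>, and the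
  two terms into \<open>(y/z)\<^sup>1\<^sup>-\<^sup>2\<^sup>/\<^sup>p sqrt N(z)\<close> with \<open>N = v / v'\<^sup>2\<close>. The factor \<open>y/z\<close> increases along both
  branches and is larger on the lower one, where \<open>sqrt N\<close> increases as well, so it suffices that the
  sum of the two \<open>sqrt N\<close> does not decrease. That is the semilinear case \<open>p = 2\<close>, and Chicone's criterion
  \<open>N'' \<ge> 0\<close> settles it.\<close>

section \<open>Real derivatives and signed powers\<close>

text \<open>L'Hopital applied to the difference quotient. It supplies derivatives at the exceptional
  points: the minimum \<open>1\<close> of the potential and the turning times of an orbit.\<close>

lemma DERIV_at_limit_of_deriv:
  fixes f f' :: "real \<Rightarrow> real"
  assumes "isCont f a"
    and "eventually (\<lambda>x. (f has_real_derivative f' x) (at x)) (at a)"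
    and "(f' \<longlongrightarrow> L) (at a)"
  shows "(f has_real_derivative L) (at a)"
proof -
  have "((\<lambda>x. (f x - f a) / (x - a)) \<longlongrightarrow> L) (at a)"
  proof (rule lhopital)
    show "((\<lambda>x. f x - f a) \<longlongrightarrow> 0) (at a)"
      using assms(1) by (simp add: isCont_def LIM_zero)
    show "((\<lambda>x. x - a) \<longlongrightarrow> 0) (at a)"
      by (rule LIM_zero) simp
    show "eventually (\<lambda>x. x - a \<noteq> 0) (at a)"
      by (simp add: eventually_at_filter)
    show "eventually (\<lambda>x. ((\<lambda>x. f x - f a) has_real_derivative f' x) (at x)) (at a)"
      using assms(2) by eventually_elim (auto intro!: derivative_eq_intros)
    show "eventually (\<lambda>x. ((\<lambda>x. x - a) has_real_derivative 1) (at x)) (at a)"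
      by (auto intro!: always_eventually derivative_eq_intros)
  qed (use assms(3) in auto)
  then show ?thesis
    by (simp add: has_field_derivative_iff)
qed

text \<open>The chain rule read backwards: Caratheodory's slope function of \<open>f\<close> is
  divided out. Only continuity of \<open>\<theta>\<close> is assumed, which suits inverse functions
  and lifted angles.\<close>

lemma DERIV_compose_cancel:
  fixes f \<theta> :: "real \<Rightarrow> real"
  assumes "isCont \<theta> t" "(f has_real_derivative d) (at (\<theta> t))" "d \<noteq> 0"
    and "((\<lambda>s. f (\<theta> s)) has_real_derivative D) (at t)"
  shows "(\<theta> has_real_derivative D / d) (at t)"
proof -
  obtain \<phi> where \<phi>: "\<And>z. f z - f (\<theta> t) = \<phi> z * (z - \<theta> t)" "isCont \<phi> (\<theta> t)" "\<phi> (\<theta> t) = d"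
    using assms(2) unfolding CARAT_DERIV by auto
  have lim: "((\<lambda>s. \<phi> (\<theta> s)) \<longlongrightarrow> d) (at t)"
    using isCont_o2[OF assms(1) \<phi>(2)] \<phi>(3) by (simp add: isCont_def)
  have "((\<lambda>s. (f (\<theta> s) - f (\<theta> t)) / (s - t) / \<phi> (\<theta> s)) \<longlongrightarrow> D / d) (at t)"
    using assms(4) lim assms(3) by (intro tendsto_divide) (auto simp: has_field_derivative_iff)
  moreover have "eventually (\<lambda>s. \<phi> (\<theta> s) \<noteq> 0) (at t)"
    using lim assms(3) by (rule tendsto_imp_eventually_ne)
  ultimately have "((\<lambda>s. (\<theta> s - \<theta> t) / (s - t)) \<longlongrightarrow> D / d) (at t)"
    by (rule Lim_transform_eventually[OF _ eventually_mono]) (simp add: \<phi>(1))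
  then show ?thesis
    by (simp add: has_field_derivative_iff)
qed

lemma DERIV_nonzero_eventually_ne:
  fixes f :: "real \<Rightarrow> real"
  assumes "(f has_real_derivative d) (at a)" "d \<noteq> 0"
  shows "eventually (\<lambda>x. f x \<noteq> f a) (at a)"
proof -
  have "((\<lambda>x. (f x - f a) / (x - a)) \<longlongrightarrow> d) (at a)"
    using assms(1) by (simp add: has_field_derivative_iff)
  from tendsto_imp_eventually_ne[OF this assms(2)] show ?thesis
    by eventually_elim auto
qed

lemma antiderivative_on_UNIV:
  fixes f :: "real \<Rightarrow> real"
  assumes "continuous_on UNIV f"
  obtains F where "\<And>x. (F has_real_derivative f x) (at x)"
proof
  fix x :: real
  \<comment> \<open>The interval contains \<open>0\<close> and has \<open>x\<close> in its interior,
    so the derivative within it is a full one.\<close>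
  let ?a = "- \<bar>x\<bar> - 1" and ?b = "\<bar>x\<bar> + 1"
  have "((\<lambda>u. LBINT y=ereal 0..ereal u. f y) has_vector_derivative f x) (at x within {?a..?b})"
    by (rule interval_integral_FTC2) (auto intro: continuous_on_subset[OF assms])
  then show "((\<lambda>u. LBINT y=ereal 0..ereal u. f y) has_real_derivative f x) (at x)"
    by (simp add: has_real_derivative_iff_has_vector_derivative at_within_Icc_at)
qed

text \<open>The line is contractible, so the nowhere vanishing map X + iY has a continuous
  logarithm; its modulus is 1, so the imaginary part is the angle.\<close>

lemma angle_lift:
  assumes "continuous_on UNIV X" "continuous_on UNIV Y" "\<And>t :: real. (X t)\<^sup>2 + (Y t)\<^sup>2 = (1 :: real)"
  obtains \<theta> where "continuous_on UNIV \<theta>" "\<And>t. X t = cos (\<theta> t)" "\<And>t. Y t = sin (\<theta> t)"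
proof -
  let ?f = "\<lambda>t. Complex (X t) (Y t)"
  have norm: "norm (?f t) = 1" for t by (simp add: complex_norm assms(3))
  have "continuous_on UNIV ?f"
    unfolding Complex_eq by (intro continuous_intros assms)
  moreover have "contractible (UNIV :: real set)" by (simp add: convex_imp_contractible)
  moreover have "?f t \<noteq> 0" for t using norm[of t] by (metis norm_zero zero_neq_one)
  ultimately obtain G where G: "continuous_on UNIV G" "\<And>t. ?f t = exp (G t)"
    using continuous_logarithm_on_contractible[of UNIV ?f] by (metis UNIV_I)
  have "exp (Re (G t)) = 1" for t using norm[of t] by (simp add: G(2))
  then have "exp (G t) = Complex (cos (Im (G t))) (sin (Im (G t)))" for t
    by (simp add: exp_eq_polar cis.code)
  then have "X t = cos (Im (G t))" "Y t = sin (Im (G t))" for t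
    using G(2)[of t] by simp_all
  moreover have "continuous_on UNIV (\<lambda>t. Im (G t))" by (intro continuous_intros G)
  ultimately show ?thesis by (rule that[rotated 1])
qed

text \<open>The odd extension of the power function. Exponents multiply under composition, so
  \<open>signed_pow p\<close>, which is \<open>spow (p - 1)\<close>, is easily inverted.\<close>

definition spow :: "real \<Rightarrow> real \<Rightarrow> real" where
  "spow a x = sgn x * \<bar>x\<bar> powr a"

lemma spow_zero [simp]: "spow a 0 = 0"
  by (simp add: spow_def)

lemma abs_spow [simp]: "\<bar>spow a x\<bar> = \<bar>x\<bar> powr a"
  by (auto simp: spow_def sgn_if abs_mult)

lemma sgn_spow [simp]: "sgn (spow a x) = sgn x"
  by (cases x "0 :: real" rule: linorder_cases) (auto simp: spow_def sgn_if)

lemma spow_spow: "spow a (spow b x) = spow (b * a) x"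
  using abs_spow[of b x] sgn_spow[of b x] by (metis powr_powr spow_def)

lemma spow_1 [simp]: "spow 1 x = x"
  by (simp add: spow_def sgn_mult_abs)

lemma spow_inj: "a \<noteq> 0 \<Longrightarrow> spow a x = spow a y \<longleftrightarrow> x = y"
  by (metis spow_spow spow_1 nonzero_mult_div_cancel_left times_divide_eq_right)

lemma spow_mult: "spow a (x * y) = spow a x * spow a y"
  by (simp add: spow_def sgn_mult abs_mult powr_mult)

lemma spow_pos: "x > 0 \<Longrightarrow> spow a x = x powr a"
  by (simp add: spow_def)

lemma DERIV_spow:
  assumes "x \<noteq> 0"
  shows "(spow a has_real_derivative a * \<bar>x\<bar> powr (a - 1)) (at x)"
proof (cases "x > 0")
  case True
  have "((\<lambda>x. x powr a) has_real_derivative a * \<bar>x\<bar> powr (a - 1)) (at x)"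
    using True by (auto intro!: derivative_eq_intros)
  then show ?thesis
    by (rule DERIV_cong_ev[THEN iffD1, rotated -1])
      (use True eventually_nhds_in_open[of "{0<..}" x] in \<open>auto simp: spow_pos elim!: eventually_mono\<close>)
next
  case False
  with assms have x: "x < 0" by simp
  have "((\<lambda>x. - ((- x) powr a)) has_real_derivative a * \<bar>x\<bar> powr (a - 1)) (at x)"
    using x by (auto intro!: derivative_eq_intros)
  then show ?thesis
    by (rule DERIV_cong_ev[THEN iffD1, rotated -1])
      (use x eventually_nhds_in_open[of "{..<0}" x] in \<open>auto simp: spow_def elim!: eventually_mono\<close>)
qed

lemma isCont_spow [continuous_intros]:
  assumes "a > 0"
  shows "isCont (spow a) x"
proof (cases "x = 0")
  case True
  have "((\<lambda>x. \<bar>x\<bar> powr a) \<longlongrightarrow> \<bar>0\<bar> powr a) (at (0::real))"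
    by (intro tendsto_powr2 tendsto_intros) (use assms in auto)
  then have "((\<lambda>x. \<bar>spow a x\<bar>) \<longlongrightarrow> 0) (at 0)"
    by simp
  then show ?thesis
    unfolding isCont_def True spow_zero by (simp only: tendsto_rabs_zero_iff)
qed (use DERIV_spow DERIV_isCont in blast)

lemma continuous_on_spow [continuous_intros]:
  "a > 0 \<Longrightarrow> continuous_on S f \<Longrightarrow> continuous_on S (\<lambda>x. spow a (f x))"
  using continuous_on_compose2[OF continuous_at_imp_continuous_on[of UNIV "spow a"]]
  by (auto simp: isCont_spow)

section \<open>Chicone's criterion for the semilinear oscillator\<close>

lemma cubic_sign:
  fixes s :: real
  shows "(1 \<le> s \<Longrightarrow> 0 \<le> (s - 1) ^ 3)" "(s \<le> 1 \<Longrightarrow> (s - 1) ^ 3 \<le> 0)"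
  by (auto simp: power_le_zero_eq)

lemma eventually_pos_ne_1: "eventually (\<lambda>z. 0 < z \<and> z \<noteq> (1::real)) (at 1)"
  using eventually_at_in_open[of "{0<..}" "1 :: real"] by (auto elim!: eventually_mono)

locale scaled_oscillator =
  fixes Q :: real
  assumes Q: "2 < Q"
begin

text \<open>In terms of \<open>s = z\<^sup>Q\<^sup>-\<^sup>2\<close>, where \<open>z\<^sup>Q = s\<^sup>Q\<^sup>/\<^sup>(\<^sup>Q\<^sup>-\<^sup>2\<^sup>)\<close>, the numerator of \<open>N''\<close> is a positive multiple
  of \<open>R2 s - z\<^sup>Q A2 s\<close>. This vanishes to fourth order at \<open>s = 1\<close>; after taking logarithms the sign of the
  derivative can be read off from a polynomial with the factor \<open>(s - 1)\<^sup>3\<close>.\<close>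

definition R2 :: "real \<Rightarrow> real" where
  "R2 s = (Q - 1) * (2 * Q - 1) * s\<^sup>2 + (Q - 1) * (Q - 8) * s + 3"

definition A2 :: "real \<Rightarrow> real" where
  "A2 s = - (Q - 1) * s\<^sup>2 + (2 * Q\<^sup>2 - 7 * Q + 8) * s + (Q - 1) * (Q - 3)"

text \<open>For \<open>Q < 13\<close> the discriminant is negative; for larger \<open>Q\<close> no
  coefficient is negative.\<close>

lemma R2_pos: "0 < s \<Longrightarrow> 0 < R2 s"
proof (cases "Q < 13")
  case True
  define a b where "a = (Q - 1) * (2 * Q - 1)" and "b = (Q - 1) * (Q - 8)"
  have a: "a > 0" using Q by (simp add: a_def)
  have "12 * a - b\<^sup>2 = (Q - 1) * (Q - 2)\<^sup>2 * (13 - Q)"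
    unfolding a_def b_def by algebra
  then have "12 * a - b\<^sup>2 > 0" using Q True by simp
  moreover have "4 * a * R2 s = (2 * a * s + b)\<^sup>2 + (12 * a - b\<^sup>2)"
    unfolding R2_def a_def[symmetric] b_def[symmetric] by algebra
  ultimately have "4 * a * R2 s > 0" by (simp add: add_nonneg_pos)
  then show ?thesis using a by (simp add: zero_less_mult_iff)
next
  case False
  assume "0 < s"
  then show ?thesis unfolding R2_def using False
    by (intro add_nonneg_pos add_nonneg_nonneg mult_nonneg_nonneg) auto
qed

text \<open>The conclusion concerns the linear factor in the derivative of \<open>\<psi>\<close>. If
  its zero \<open>s0\<close> is positive, then \<open>A2\<close> increases up to \<open>s0\<close>
  and \<open>A2 s0 \<le> 0\<close>, so \<open>A2\<close> is positive nowhere before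
  \<open>s0\<close>.\<close>

lemma A2_pos_imp:
  assumes "0 < s" "s < 1" "0 < A2 s"
  shows "0 < (Q - 1) * (2 * Q - 1) * s + 3 * (Q - 3)"
proof (rule ccontr)
  assume "\<not> ?thesis"
  then have le: "(Q - 1) * (2 * Q - 1) * s \<le> 3 * (3 - Q)" by simp
  define d where "d = (Q - 1) * (2 * Q - 1)"
  define s0 where "s0 = 3 * (3 - Q) / d"
  have d: "d > 0" using Q by (simp add: d_def)
  have ss0: "s \<le> s0" using le d unfolding s0_def d_def by (simp add: pos_le_divide_eq mult.commute)
  have s0: "s0 > 0" using ss0 assms by simp
  have Q3: "Q < 3" using s0 d by (simp add: s0_def zero_less_divide_iff)
  have ds0: "d * s0 = 3 * (3 - Q)" using d by (simp add: s0_def)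
  have "d * (2 * Q - 1) * A2 s0 * (Q - 1) = (Q - 1) * ((3 - Q) * (- ((Q - 2)\<^sup>2 * (4 * Q\<^sup>2 - 8 * Q + 13))))"
    using ds0 unfolding A2_def d_def by algebra
  moreover have "4 * Q\<^sup>2 - 8 * Q + 13 > 0"
  proof -
    have "4 * Q\<^sup>2 - 8 * Q + 13 = 4 * (Q - 1)\<^sup>2 + 9" by algebra
    then show ?thesis using zero_le_power2[of "Q - 1"] by linarith
  qed
  ultimately have "d * (2 * Q - 1) * A2 s0 * (Q - 1) \<le> 0"
    using Q Q3 by (simp add: mult_nonneg_nonneg)
  then have A0: "A2 s0 \<le> 0"
    using d Q by (simp add: mult_le_0_iff)
  \<comment> \<open>This leads to a nonnegative slope of the concave \<open>A2\<close> at
    \<open>s0\<close>.\<close>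
  have "(2 * Q - 1) * (2 * Q\<^sup>2 - 7 * Q + 8) - 6 * (3 - Q) = (Q - 2) * (4 * Q\<^sup>2 - 8 * Q + 13)"
    by algebra
  also have "\<dots> \<ge> 0" using Q \<open>4 * Q\<^sup>2 - 8 * Q + 13 > 0\<close> by simp
  finally have "6 * (3 - Q) \<le> (2 * Q - 1) * (2 * Q\<^sup>2 - 7 * Q + 8)" by simp
  moreover have "(2 * Q - 1) * ((Q - 1) * (2 * s0)) = 6 * (3 - Q)" using ds0 unfolding d_def by algebra
  ultimately have "(2 * Q - 1) * ((Q - 1) * (2 * s0)) \<le> (2 * Q - 1) * (2 * Q\<^sup>2 - 7 * Q + 8)" by simp
  then have "(Q - 1) * (2 * s0) \<le> 2 * Q\<^sup>2 - 7 * Q + 8"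
    using Q by (subst (asm) mult_le_cancel_left_pos) auto
  moreover have "(Q - 1) * (s + s0) \<le> (Q - 1) * (2 * s0)"
    using ss0 Q by (intro mult_left_mono) auto
  ultimately have "0 \<le> (s0 - s) * (2 * Q\<^sup>2 - 7 * Q + 8 - (Q - 1) * (s + s0))"
    using ss0 by simp
  also have "\<dots> = A2 s0 - A2 s" unfolding A2_def by algebra
  finally show False using A0 assms by simp
qed

text \<open>\<open>A2\<close> is concave, so its positivity set is an interval; the identity used is
  linear interpolation plus the concavity gap.\<close>

lemma A2_pos_between:
  assumes "0 < A2 x" "0 < A2 y" "x \<le> \<sigma>" "\<sigma> \<le> y"
  shows "0 < A2 \<sigma>"
proof (cases "x = y")
  case False
  with assms have xy: "x < y" by simp
  have "(y - x) * A2 \<sigma> = (y - \<sigma>) * A2 x + (\<sigma> - x) * A2 y + (Q - 1) * (y - x) * ((\<sigma> - x) * (y - \<sigma>))"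
    unfolding A2_def by algebra
  moreover have "(y - \<sigma>) * A2 x + (\<sigma> - x) * A2 y > 0"
    using assms xy by (cases "\<sigma> = x") (auto intro: add_nonneg_pos)
  moreover have "(Q - 1) * (y - x) * ((\<sigma> - x) * (y - \<sigma>)) \<ge> 0"
    using assms xy Q by simp
  ultimately have "(y - x) * A2 \<sigma> > 0" by linarith
  then show ?thesis using xy by (simp add: zero_less_mult_iff)
qed (use assms in auto)

lemma A2_1: "A2 1 = 3 * (Q - 2)\<^sup>2" and R2_1: "R2 1 = 3 * (Q - 2)\<^sup>2"
  unfolding A2_def R2_def by (simp; algebra)+

text \<open>The logarithm of the quotient of \<open>R2 s\<close> by
  \<open>s powr (Q / (Q - 2)) * A2 s\<close>, considered where \<open>A2 s > 0\<close>. Its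
  derivative is rational.\<close>

definition \<psi> :: "real \<Rightarrow> real" where
  "\<psi> s = ln (R2 s) - ln (A2 s) - Q / (Q - 2) * ln s"

lemma DERIV_\<psi>:
  assumes "0 < s" "0 < A2 s"
  shows "(\<psi> has_real_derivative
     (s - 1) ^ 3 * (Q * (Q - 1) * ((Q - 1) * (2 * Q - 1) * s + 3 * (Q - 3))) / ((Q - 2) * s * R2 s * A2 s)) (at s)"
proof -
  define R' A' where "R' = 2 * (Q - 1) * (2 * Q - 1) * s + (Q - 1) * (Q - 8)"
    and "A' = - 2 * (Q - 1) * s + (2 * Q\<^sup>2 - 7 * Q + 8)"
  have R: "0 < R2 s" using R2_pos assms by simp
  have "(R2 has_real_derivative R') (at s)"
    unfolding R2_def R'_def by (auto intro!: derivative_eq_intros simp: algebra_simps)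
  moreover have "(A2 has_real_derivative A') (at s)"
    unfolding A2_def A'_def by (auto intro!: derivative_eq_intros simp: algebra_simps)
  ultimately have "(\<psi> has_real_derivative R' / R2 s - A' / A2 s - Q / (Q - 2) * (1 / s)) (at s)"
    unfolding \<psi>_def using R assms by (auto intro!: derivative_eq_intros simp: divide_inverse)
  moreover have "R' / R2 s - A' / A2 s - Q / (Q - 2) * (1 / s)
     = ((Q - 2) * s * (R' * A2 s - R2 s * A') - Q * R2 s * A2 s) / ((Q - 2) * s * R2 s * A2 s)"
    using R assms Q by (simp add: divide_simps)
  moreover have "(Q - 2) * s * (R' * A2 s - R2 s * A') - Q * R2 s * A2 s
     = (s - 1) ^ 3 * (Q * (Q - 1) * ((Q - 1) * (2 * Q - 1) * s + 3 * (Q - 3)))"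
    unfolding R'_def A'_def R2_def A2_def by algebra
  ultimately show ?thesis by simp
qed

text \<open>\<open>\<psi>\<close> vanishes at \<open>1\<close>. Between \<open>1\<close> and
  \<open>s\<close> the quadratic \<open>A2\<close> stays positive and the linear factor nonnegative,
  so the derivative takes its sign from the cube of the distance to \<open>1\<close>.\<close>

lemma \<psi>_nonneg:
  assumes s: "0 < s" "0 < A2 s"
  shows "0 \<le> \<psi> s"
proof -
  have \<psi>1: "\<psi> 1 = 0" by (simp add: \<psi>_def A2_1 R2_1)
  have A1: "A2 1 > 0" using Q by (simp add: A2_1)
  show ?thesis
  proof (cases "1 \<le> s")
    case True
    have "\<psi> 1 \<le> \<psi> s"
    proof (rule DERIV_nonneg_imp_nondecreasing[OF True])
      fix x assume x: "1 \<le> x" "x \<le> s"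
      have "0 < A2 x" using A2_pos_between[OF A1 s(2)] x by simp
      moreover have "(Q - 1) * (2 * Q - 1) * x + 3 * (Q - 3) \<ge> 0"
      proof -
        have "(Q - 1) * (2 * Q - 1) * 1 \<le> (Q - 1) * (2 * Q - 1) * x"
          using x Q by (intro mult_left_mono) auto
        moreover have "(Q - 1) * (2 * Q - 1) + 3 * (Q - 3) = 2 * (Q - 2) * (Q + 2)" by algebra
        moreover have "2 * (Q - 2) * (Q + 2) \<ge> 0" using Q by simp
        ultimately show ?thesis by linarith
      qed
      ultimately show "\<exists>y. (\<psi> has_real_derivative y) (at x) \<and> 0 \<le> y"
        using x Q R2_pos[of x] cubic_sign(1)[of x]
        by - (rule exI, rule conjI[OF DERIV_\<psi>], auto intro!: divide_nonneg_nonneg mult_nonneg_nonneg)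
    qed
    then show ?thesis by (simp add: \<psi>1)
  next
    case False
    then have s1: "s < 1" by simp
    have "\<psi> 1 \<le> \<psi> s"
    proof (rule DERIV_nonpos_imp_nonincreasing[where f = \<psi> and a = s and b = 1])
      show "s \<le> 1" using s1 by simp
      fix x assume x: "s \<le> x" "x \<le> 1"
      have "0 < A2 x" using A2_pos_between[OF s(2) A1] x by simp
      moreover have "(Q - 1) * (2 * Q - 1) * x + 3 * (Q - 3) \<ge> 0"
      proof -
        have "(Q - 1) * (2 * Q - 1) * s \<le> (Q - 1) * (2 * Q - 1) * x"
          using x Q by (intro mult_left_mono) auto
        then show ?thesis using A2_pos_imp[OF s(1) s1 s(2)] by linarith
      qed
      ultimately show "\<exists>y. (\<psi> has_real_derivative y) (at x) \<and> y \<le> 0"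
        using x s Q R2_pos[of x] cubic_sign(2)[of x]
        by - (rule exI, rule conjI[OF DERIV_\<psi>], auto intro!: divide_nonpos_nonneg mult_nonpos_nonneg mult_nonneg_nonneg)
    qed
    then show ?thesis by (simp add: \<psi>1)
  qed
qed

lemma R2_ge_powr_A2:
  assumes "0 < s"
  shows "s powr (Q / (Q - 2)) * A2 s \<le> R2 s"
proof (cases "0 < A2 s")
  case True
  have "ln (s powr (Q / (Q - 2)) * A2 s) = Q / (Q - 2) * ln s + ln (A2 s)"
    using assms True by (simp add: ln_mult ln_powr)
  also have "\<dots> \<le> ln (R2 s)" using \<psi>_nonneg[OF assms True] by (simp add: \<psi>_def)
  finally show ?thesis using R2_pos[OF assms] True assms by simp
next
  case False
  then have "s powr (Q / (Q - 2)) * A2 s \<le> 0" by (simp add: mult_nonneg_nonpos)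
  then show ?thesis using R2_pos[OF assms] by linarith
qed

section \<open>The semilinear potential with exponents \<open>2\<close> and \<open>Q\<close>\<close>

definition v :: "real \<Rightarrow> real" where "v z = z powr Q / Q - z\<^sup>2 / 2 + (1 / 2 - 1 / Q)"
definition v1 :: "real \<Rightarrow> real" where "v1 z = z powr (Q - 1) - z"
definition v2 :: "real \<Rightarrow> real" where "v2 z = (Q - 1) * z powr (Q - 2) - 1"
definition v3 :: "real \<Rightarrow> real" where "v3 z = (Q - 1) * (Q - 2) * z powr (Q - 3)"

lemma DERIV_v:
  assumes "0 < z"
  shows "(v has_real_derivative v1 z) (at z)" "(v1 has_real_derivative v2 z) (at z)"
    "(v2 has_real_derivative v3 z) (at z)"
  unfolding v_def v1_def v2_def v3_def using assms Q
  by (auto intro!: derivative_eq_intros simp: algebra_simps)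

lemma powr_reduce:
  assumes "0 < z"
  shows "z powr Q = z\<^sup>2 * z powr (Q - 2)" "z powr (Q - 1) = z * z powr (Q - 2)"
    "z powr (Q - 3) = z powr (Q - 2) / z" "z powr Q = (z powr (Q - 2)) powr (Q / (Q - 2))"
proof -
  show "z powr Q = z\<^sup>2 * z powr (Q - 2)"
    using assms powr_add[of z 2 "Q - 2"] by simp
  show "z powr (Q - 1) = z * z powr (Q - 2)"
    using assms powr_add[of z 1 "Q - 2"] by simp
  show "z powr (Q - 3) = z powr (Q - 2) / z"
    using assms powr_diff[of z "Q - 2" 1] by simp
  show "z powr Q = (z powr (Q - 2)) powr (Q / (Q - 2))"
    using Q by (simp add: powr_powr)
qed

text \<open>Away from \<open>1\<close> this is \<open>(v1 z) ^ 4\<close> times the second derivative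
  of \<open>v / v1^2\<close>. It is polynomial in \<open>s\<close> and \<open>z^2\<close> and
  collapses to a positive multiple of \<open>R2 s - z powr Q * A2 s\<close>.\<close>

lemma chicone_numerator_nonneg:
  assumes z: "0 < z"
  shows "0 \<le> 6 * v z * (v2 z)\<^sup>2 - 3 * (v1 z)\<^sup>2 * v2 z - 2 * v z * v1 z * v3 z"
proof -
  define s where "s = z powr (Q - 2)"
  have s: "0 < s" using z by (simp add: s_def)
  have e: "v z = z\<^sup>2 * s / Q - z\<^sup>2 / 2 + (1 / 2 - 1 / Q)" "v1 z = z * s - z" "v2 z = (Q - 1) * s - 1"
    "v3 z = (Q - 1) * (Q - 2) * (s / z)"
    using powr_reduce[OF z] by (simp_all add: v_def v1_def v2_def v3_def s_def)
  have "v1 z * v3 z = (Q - 1) * (Q - 2) * s * (s - 1)"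
    using z by (simp add: e field_simps)
  then have "6 * v z * (v2 z)\<^sup>2 - 3 * (v1 z)\<^sup>2 * v2 z - 2 * v z * v1 z * v3 z
     = v z * (6 * ((Q - 1) * s - 1)\<^sup>2 - 2 * ((Q - 1) * (Q - 2) * s * (s - 1))) - 3 * (z * s - z)\<^sup>2 * ((Q - 1) * s - 1)"
    unfolding e(2)[symmetric] e(3)[symmetric] by algebra
  also have "\<dots> = ((Q - 2) / Q) * (R2 s - z\<^sup>2 * s * A2 s)"
  proof -
    have qv: "Q * v z = z\<^sup>2 * s - Q * z\<^sup>2 / 2 + (Q - 2) / 2"
      using Q by (simp add: e(1) field_simps)
    have "2 * (Q * v z) * (6 * ((Q - 1) * s - 1)\<^sup>2 - 2 * ((Q - 1) * (Q - 2) * s * (s - 1))) - 2 * Q * (3 * (z * s - z)\<^sup>2 * ((Q - 1) * s - 1))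
      = 2 * ((Q - 2) * (R2 s - z\<^sup>2 * s * A2 s))"
      unfolding qv R2_def A2_def by (simp add: field_simps) algebra
    then show ?thesis using Q by (simp add: field_simps)
  qed
  also have "z\<^sup>2 * s = s powr (Q / (Q - 2))"
    using powr_reduce[OF z] by (simp add: s_def)
  finally show ?thesis
    using R2_ge_powr_A2[OF s] Q by simp
qed


text \<open>\<open>4 N\<close> is the square of the derivative of the inverse of \<open>\<plusminus>sqrt v\<close>.\<close>

definition N :: "real \<Rightarrow> real" where "N z = v z / (v1 z)\<^sup>2"
definition N' :: "real \<Rightarrow> real" where "N' z = ((v1 z)\<^sup>2 - 2 * v z * v2 z) / (v1 z) ^ 3"

lemma v1_sign: "0 < z \<Longrightarrow> z < 1 \<Longrightarrow> v1 z < 0" "1 < z \<Longrightarrow> 0 < v1 z"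
proof -
  assume z: "0 < z" "z < 1"
  then have "z powr (Q - 1) < z powr 1" using Q by (intro powr_less_mono') auto
  then show "v1 z < 0" using z by (simp add: v1_def)
next
  assume z: "1 < z"
  then have "z powr 1 < z powr (Q - 1)" using Q by (intro powr_less_mono) auto
  then show "0 < v1 z" using z by (simp add: v1_def)
qed

lemma at_1_simps [simp]: "v 1 = 0" "v1 1 = 0" "v2 1 = Q - 2" "v3 1 = (Q - 1) * (Q - 2)"
  by (simp_all add: v_def v1_def v2_def v3_def)

lemma v_pos:
  assumes "0 < z" "z \<noteq> 1"
  shows "0 < v z"
proof (cases "1 < z")
  case True
  have "v 1 < v z"
  proof (rule DERIV_pos_imp_increasing_open[OF True])
    show "\<exists>y. (v has_real_derivative y) (at x) \<and> 0 < y" if "1 < x" "x < z" for x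
      using that DERIV_v(1)[of x] v1_sign(2)[of x] by auto
    show "continuous_on {1..z} v"
      by (intro continuous_at_imp_continuous_on ballI DERIV_isCont[OF DERIV_v(1)]) auto
  qed
  then show ?thesis by simp
next
  case False
  with assms have z: "z < 1" by simp
  have "v 1 < v z"
  proof (rule DERIV_neg_imp_decreasing_open[OF z])
    show "\<exists>y. (v has_real_derivative y) (at x) \<and> y < 0" if "z < x" "x < 1" for x
      using that assms DERIV_v(1)[of x] v1_sign(1)[of x] by (intro exI[of _ "v1 x"]) auto
    show "continuous_on {z..1} v"
      using assms by (intro continuous_at_imp_continuous_on ballI DERIV_isCont[OF DERIV_v(1)]) auto
  qed
  then show ?thesis by simp
qed

lemma DERIV_N:
  assumes "0 < z" "z \<noteq> 1"
  shows "(N has_real_derivative N' z) (at z)"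
proof -
  have "v1 z \<noteq> 0" using v1_sign[of z] assms by (cases "z < 1") auto
  then have "(N has_real_derivative (v1 z * (v1 z)\<^sup>2 - v z * (2 * v1 z * v2 z)) / ((v1 z)\<^sup>2 * (v1 z)\<^sup>2)) (at z)"
    unfolding N_def by (auto intro!: derivative_eq_intros DERIV_v assms)
  also have "(v1 z * (v1 z)\<^sup>2 - v z * (2 * v1 z * v2 z)) / ((v1 z)\<^sup>2 * (v1 z)\<^sup>2) = N' z"
    using \<open>v1 z \<noteq> 0\<close> unfolding N'_def by (simp add: divide_simps) algebra
  finally show ?thesis .
qed

text \<open>Convexity of \<open>N\<close> on each side of \<open>1\<close>. At \<open>1\<close>
  itself the quotient degenerates, and the two sides are joined later through the limit of
  \<open>N'\<close>.\<close>

lemma DERIV_N':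
  assumes "0 < z" "z \<noteq> 1"
  shows "\<exists>y. (N' has_real_derivative y) (at z) \<and> 0 \<le> y"
proof -
  have v1: "v1 z \<noteq> 0" using v1_sign[of z] assms by (cases "z < 1") auto
  let ?P = "6 * v z * (v2 z)\<^sup>2 - 3 * (v1 z)\<^sup>2 * v2 z - 2 * v z * v1 z * v3 z"
  let ?d = "((2 * v1 z * v2 z - (2 * v1 z * v2 z + 2 * v z * v3 z)) * (v1 z) ^ 3
      - ((v1 z)\<^sup>2 - 2 * v z * v2 z) * (3 * (v1 z)\<^sup>2 * v2 z)) / ((v1 z) ^ 3 * (v1 z) ^ 3)"
  have "(N' has_real_derivative ?d) (at z)"
    unfolding N'_def using v1 by (auto intro!: derivative_eq_intros DERIV_v assms simp: algebra_simps)
  also have "?d = ?P / (v1 z) ^ 4"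
    using v1 by (simp add: divide_simps) algebra
  finally show ?thesis
    using chicone_numerator_nonneg[OF assms(1)] by (intro exI conjI) auto
qed

section \<open>Slopes of \<open>N\<close> on the two sides of the minimum\<close>

lemma tendsto_at_1: "(v \<longlongrightarrow> 0) (at 1)" "(v1 \<longlongrightarrow> 0) (at 1)" "(v2 \<longlongrightarrow> Q - 2) (at 1)"
  "(v3 \<longlongrightarrow> (Q - 1) * (Q - 2)) (at 1)"
proof -
  show "(v \<longlongrightarrow> 0) (at 1)" "(v1 \<longlongrightarrow> 0) (at 1)" "(v2 \<longlongrightarrow> Q - 2) (at 1)"
    using DERIV_isCont[OF DERIV_v(1)[of 1]] DERIV_isCont[OF DERIV_v(2)[of 1]] DERIV_isCont[OF DERIV_v(3)[of 1]]
    by (simp_all add: isCont_def)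
  have "(v3 \<longlongrightarrow> v3 1) (at 1)" unfolding v3_def by (intro tendsto_intros) auto
  then show "(v3 \<longlongrightarrow> (Q - 1) * (Q - 2)) (at 1)" by simp
qed

lemma eventually_regular: "eventually (\<lambda>z. 0 < z \<and> z \<noteq> 1 \<and> v1 z \<noteq> 0 \<and> v2 z \<noteq> 0) (at 1)"
proof -
  have "eventually (\<lambda>z. v2 z \<noteq> 0) (at 1)"
    by (rule tendsto_imp_eventually_ne[OF tendsto_at_1(3)]) (use Q in simp)
  with eventually_pos_ne_1 show ?thesis
  proof eventually_elim
    case (elim z)
    then show ?case using v1_sign[of z] by (cases "z < 1") auto
  qed
qed

text \<open>The quotient \<open>N\<close> reappears when l'Hopital's rule is applied to
  \<open>N'\<close>.\<close>

lemma N_tendsto_1: "(N \<longlongrightarrow> 1 / (2 * (Q - 2))) (at 1)"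
  unfolding N_def
proof (rule lhopital)
  note ev = eventually_regular
  show "(v \<longlongrightarrow> 0) (at 1)" by (fact tendsto_at_1)
  show "((\<lambda>z. (v1 z)\<^sup>2) \<longlongrightarrow> 0) (at 1)"
    using tendsto_power[OF tendsto_at_1(2), of 2] by simp
  show "\<forall>\<^sub>F z in at 1. (v1 z)\<^sup>2 \<noteq> 0" "\<forall>\<^sub>F z in at 1. 2 * v1 z * v2 z \<noteq> 0"
    using ev by (auto elim: eventually_mono)
  show "\<forall>\<^sub>F z in at 1. (v has_real_derivative v1 z) (at z)"
    using ev by eventually_elim (simp add: DERIV_v)
  show "\<forall>\<^sub>F z in at 1. ((\<lambda>z. (v1 z)\<^sup>2) has_real_derivative 2 * v1 z * v2 z) (at z)"
    using ev by eventually_elim (auto intro!: derivative_eq_intros DERIV_v)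
  have "((\<lambda>z. 1 / (2 * v2 z)) \<longlongrightarrow> 1 / (2 * (Q - 2))) (at 1)"
    using Q by (intro tendsto_intros tendsto_at_1) auto
  then show "((\<lambda>z. v1 z / (2 * v1 z * v2 z)) \<longlongrightarrow> 1 / (2 * (Q - 2))) (at 1)"
    by (rule Lim_transform_eventually) (use ev in \<open>auto elim!: eventually_mono\<close>)
qed

text \<open>One differentiation suffices: the terms \<open>v1 * v2\<close> cancel in the numerator,
  and the quotient becomes \<open>- 2 / 3 * N z * v3 z / v2 z\<close>.\<close>

lemma N'_tendsto_1: "(N' \<longlongrightarrow> - (Q - 1) / (3 * (Q - 2))) (at 1)"
  unfolding N'_def
proof (rule lhopital)
  note ev = eventually_regular
  have "((\<lambda>z. (v1 z)\<^sup>2 - 2 * v z * v2 z) \<longlongrightarrow> 0\<^sup>2 - 2 * 0 * (Q - 2)) (at 1)"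
    by (intro tendsto_intros tendsto_at_1)
  then show "((\<lambda>z. (v1 z)\<^sup>2 - 2 * v z * v2 z) \<longlongrightarrow> 0) (at 1)" by simp
  show "((\<lambda>z. (v1 z) ^ 3) \<longlongrightarrow> 0) (at 1)"
    using tendsto_power[OF tendsto_at_1(2), of 3] by simp
  show "\<forall>\<^sub>F z in at 1. (v1 z) ^ 3 \<noteq> 0" "\<forall>\<^sub>F z in at 1. 3 * (v1 z)\<^sup>2 * v2 z \<noteq> 0"
    using ev by (auto elim: eventually_mono)
  show "\<forall>\<^sub>F z in at 1. ((\<lambda>z. (v1 z)\<^sup>2 - 2 * v z * v2 z) has_real_derivative - 2 * v z * v3 z) (at z)"
    using ev by eventually_elim (auto intro!: derivative_eq_intros DERIV_v simp: algebra_simps)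
  show "\<forall>\<^sub>F z in at 1. ((\<lambda>z. (v1 z) ^ 3) has_real_derivative 3 * (v1 z)\<^sup>2 * v2 z) (at z)"
    using ev by eventually_elim (auto intro!: derivative_eq_intros DERIV_v)
  have "((\<lambda>z. - 2 / 3 * N z * v3 z / v2 z) \<longlongrightarrow> - 2 / 3 * (1 / (2 * (Q - 2))) * ((Q - 1) * (Q - 2)) / (Q - 2)) (at 1)"
    using Q by (intro tendsto_intros tendsto_at_1 N_tendsto_1) auto
  moreover have "- 2 / 3 * (1 / (2 * (Q - 2))) * ((Q - 1) * (Q - 2)) / (Q - 2) = - (Q - 1) / (3 * (Q - 2))"
    using Q by (simp add: divide_simps) (simp add: algebra_simps)
  ultimately have "((\<lambda>z. - 2 / 3 * N z * v3 z / v2 z) \<longlongrightarrow> - (Q - 1) / (3 * (Q - 2))) (at 1)"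
    by (simp only:)
  then show "((\<lambda>z. - 2 * v z * v3 z / (3 * (v1 z)\<^sup>2 * v2 z)) \<longlongrightarrow> - (Q - 1) / (3 * (Q - 2))) (at 1)"
    by (rule Lim_transform_eventually) (use ev in \<open>auto elim!: eventually_mono simp: N_def\<close>)
qed

lemma N'_mono:
  assumes "0 < x" "x \<le> y" "y < 1 \<or> 1 < x"
  shows "N' x \<le> N' y"
  using assms by (intro DERIV_nonneg_imp_nondecreasing[OF assms(2)] DERIV_N') auto

text \<open>\<open>N'\<close> is nondecreasing on (0,1), hence below its limit at \<open>1\<close>.
  With the mirror statement above \<open>1\<close>, this common limit separates the slopes of the
  two branches.\<close>

lemma N'_le_limit:
  assumes "0 < x" "x < 1"
  shows "N' x \<le> - (Q - 1) / (3 * (Q - 2))"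
proof (rule tendsto_lowerbound)
  show "(N' \<longlongrightarrow> - (Q - 1) / (3 * (Q - 2))) (at_left 1)"
    using N'_tendsto_1 by (rule filterlim_mono) (auto intro: at_le)
  show "\<forall>\<^sub>F y in at_left 1. N' x \<le> N' y"
    using eventually_at_left_real[OF assms(2)]
    by eventually_elim (use assms in \<open>auto intro!: N'_mono\<close>)
qed simp

lemma N'_ge_limit:
  assumes "1 < x"
  shows "- (Q - 1) / (3 * (Q - 2)) \<le> N' x"
proof (rule tendsto_upperbound)
  show "(N' \<longlongrightarrow> - (Q - 1) / (3 * (Q - 2))) (at_right 1)"
    using N'_tendsto_1 by (rule filterlim_mono) (auto intro: at_le)
  show "\<forall>\<^sub>F y in at_right 1. N' y \<le> N' x"
    using eventually_at_right_real[OF assms]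
    by eventually_elim (use assms in \<open>auto intro!: N'_mono\<close>)
qed simp

lemma N'_neg: "0 < x \<Longrightarrow> x < 1 \<Longrightarrow> N' x < 0"
proof -
  have "- (Q - 1) / (3 * (Q - 2)) < 0" using Q by (simp add: divide_neg_pos)
  then show "0 < x \<Longrightarrow> x < 1 \<Longrightarrow> N' x < 0" using N'_le_limit[of x] by linarith
qed

text \<open>The derivative is a positive multiple of \<open>z powr Q - 1\<close>. Since
  \<open>y^2\<close> is a multiple of \<open>v z\<close>, this controls the factor
  \<open>y / z\<close> on the upper branch.\<close>

lemma v_over_square_mono:
  assumes "1 \<le> x" "x \<le> y"
  shows "v x / x\<^sup>2 \<le> v y / y\<^sup>2"
proof (rule DERIV_nonneg_imp_nondecreasing[OF assms(2)])
  fix z assume "x \<le> z"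
  with assms have z: "1 \<le> z" by simp
  have "((\<lambda>x. v x / x\<^sup>2) has_real_derivative (v1 z * z\<^sup>2 - v z * (2 * z)) / (z\<^sup>2 * z\<^sup>2)) (at z)"
    using z by (auto intro!: derivative_eq_intros DERIV_v)
  moreover have "v1 z * z\<^sup>2 - v z * (2 * z) = z * ((Q - 2) / Q * (z powr Q - 1))"
    using z Q powr_reduce[of z] by (simp add: v1_def v_def field_simps power2_eq_square)
  moreover have "1 \<le> z powr Q" using z Q by (simp add: ge_one_powr_ge_zero)
  ultimately show "\<exists>d. ((\<lambda>x. v x / x\<^sup>2) has_real_derivative d) (at z) \<and> 0 \<le> d"
    using z Q by (intro exI conjI) auto
qed

end

section \<open>Straightening the potential\<close>

locale plaplace =
  fixes p q :: real
  assumes p: "2 < p" and pq: "p < q"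
begin

section \<open>The potential and its two monotone branches\<close>

abbreviation "Emax \<equiv> max_energy p q"
abbreviation "V \<equiv> potential p q"
definition V' :: "real \<Rightarrow> real" where "V' x = x powr (q - 1) - x powr (p - 1)"
definition V'' :: "real \<Rightarrow> real" where "V'' x = (q - 1) * x powr (q - 2) - (p - 1) * x powr (p - 2)"

lemma Emax_pos: "0 < Emax"
  using p pq by (simp add: max_energy_def field_simps)

lemma V_pos_arg: "0 < x \<Longrightarrow> V x = x powr q / q - x powr p / p + Emax"
  by (simp add: potential_def max_energy_def)

lemma DERIV_V:
  assumes "0 < x"
  shows "(V has_real_derivative V' x) (at x)"
proof -
  have "((\<lambda>x. x powr q / q - x powr p / p + Emax) has_real_derivative V' x) (at x)"
    unfolding V'_def using assms p pq by (auto intro!: derivative_eq_intros)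
  then show ?thesis
    by (rule DERIV_cong_ev[THEN iffD1, rotated -1])
      (use assms eventually_nhds_in_open[of "{0<..}" x] in \<open>auto simp: V_pos_arg elim!: eventually_mono\<close>)
qed

lemma DERIV_V':
  assumes "0 < x"
  shows "(V' has_real_derivative V'' x) (at x)"
  unfolding V'_def V''_def using assms p pq by (auto intro!: derivative_eq_intros simp: algebra_simps)

lemma V'_sign: "0 < x \<Longrightarrow> x < 1 \<Longrightarrow> V' x < 0" "1 < x \<Longrightarrow> 0 < V' x"
proof -
  assume x: "0 < x" "x < 1"
  then have "x powr (q - 1) < x powr (p - 1)" using pq by (intro powr_less_mono') auto
  then show "V' x < 0" by (simp add: V'_def)
next
  assume x: "1 < x"
  then have "x powr (p - 1) < x powr (q - 1)" using pq by (intro powr_less_mono) auto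
  then show "0 < V' x" by (simp add: V'_def)
qed

lemma V_1 [simp]: "V 1 = 0" and V'_1 [simp]: "V' 1 = 0" and V''_1 [simp]: "V'' 1 = q - p"
  by (simp_all add: potential_def V'_def V''_def)

lemma continuous_on_V: "S \<subseteq> {0<..} \<Longrightarrow> continuous_on S V"
  by (intro continuous_at_imp_continuous_on ballI DERIV_isCont[OF DERIV_V]) auto

lemma V_strict_mono: "1 \<le> x \<Longrightarrow> x < y \<Longrightarrow> V x < V y"
proof -
  assume x: "1 \<le> x" "x < y"
  show "V x < V y"
  proof (rule DERIV_pos_imp_increasing_open[OF x(2)])
    show "\<exists>d. (V has_real_derivative d) (at z) \<and> 0 < d" if "x < z" "z < y" for z
      using that x DERIV_V[of z] V'_sign(2)[of z] by (intro exI[of _ "V' z"]) auto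
    show "continuous_on {x..y} V" using x by (intro continuous_on_V) auto
  qed
qed

lemma V_strict_antimono: "0 < x \<Longrightarrow> x < y \<Longrightarrow> y \<le> 1 \<Longrightarrow> V y < V x"
proof -
  assume x: "0 < x" "x < y" "y \<le> 1"
  show "V y < V x"
  proof (rule DERIV_neg_imp_decreasing_open[OF x(2)])
    show "\<exists>d. (V has_real_derivative d) (at z) \<and> d < 0" if "x < z" "z < y" for z
      using that x DERIV_V[of z] V'_sign(1)[of z] by (intro exI[of _ "V' z"]) auto
    show "continuous_on {x..y} V" using x by (intro continuous_on_V) auto
  qed
qed

lemma V_pos: "0 < x \<Longrightarrow> x \<noteq> 1 \<Longrightarrow> 0 < V x"
  using V_strict_mono[of 1 x] V_strict_antimono[of x 1] by (cases "1 < x") auto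

lemma V_nonneg: "0 < x \<Longrightarrow> 0 \<le> V x"
  using V_pos[of x] by (cases "x = 1") auto

text \<open>The sign makes \<open>h\<close> continuously differentiable at the minimum \<open>1\<close> of \<open>V\<close>, where its derivative
  is \<open>sqrt (V'' 1 / 2)\<close>.\<close>

definition h :: "real \<Rightarrow> real" where "h x = sgn (x - 1) * sqrt (V x)"
definition H :: "real \<Rightarrow> real" where
  "H x = (if x = 1 then sqrt ((q - p) / 2) else V' x / (2 * h x))"

lemma h_1 [simp]: "h 1 = 0" by (simp add: h_def)

lemma h_sq: "0 < x \<Longrightarrow> (h x)\<^sup>2 = V x"
  using V_nonneg[of x] by (auto simp: h_def power_mult_distrib sgn_if)

lemma h_sign: "0 < x \<Longrightarrow> x < 1 \<Longrightarrow> h x < 0" "1 < x \<Longrightarrow> 0 < h x"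
  using V_pos[of x] by (auto simp: h_def)

lemma h_mult_H: "0 < x \<Longrightarrow> 2 * h x * H x = V' x"
  using h_sign[of x] by (cases "x = 1"; cases "x < 1") (auto simp: H_def)

lemma H_pos: "0 < x \<Longrightarrow> 0 < H x"
proof -
  assume x: "0 < x"
  consider "x = 1" | "x < 1" | "1 < x" by linarith
  then show "0 < H x"
    using x pq h_sign[of x] V'_sign[of x]
    by cases (auto simp: H_def divide_neg_neg zero_less_divide_iff)
qed

lemma DERIV_h_ne1:
  assumes "0 < x" "x \<noteq> 1"
  shows "(h has_real_derivative H x) (at x)"
proof -
  have "((\<lambda>y. sgn (x - 1) * sqrt (V y)) has_real_derivative sgn (x - 1) * (V' x / (2 * sqrt (V x)))) (at x)"
    using V_pos[OF assms] assms by (auto intro!: derivative_eq_intros DERIV_V simp: field_simps)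
  moreover have "sgn (x - 1) * (V' x / (2 * sqrt (V x))) = H x"
    using assms by (auto simp: H_def h_def sgn_if)
  moreover have "eventually (\<lambda>y. sgn (x - 1) * sqrt (V y) = h y) (nhds x)"
  proof (cases "x < 1")
    case True
    then show ?thesis using eventually_nhds_in_open[of "{..<1}" x]
      by (auto simp: h_def elim!: eventually_mono)
  next
    case False
    with assms show ?thesis using eventually_nhds_in_open[of "{1<..}" x]
      by (auto simp: h_def elim!: eventually_mono)
  qed
  ultimately show ?thesis
    using DERIV_cong_ev[of x x "\<lambda>y. sgn (x - 1) * sqrt (V y)" h "H x" "H x"] by simp
qed

lemma isCont_h_1: "isCont h 1"
proof -
  have "((\<lambda>x. sqrt (V x)) \<longlongrightarrow> sqrt (V 1)) (at 1)"
    using DERIV_isCont[OF DERIV_V[of 1]] unfolding isCont_def by (intro tendsto_intros) auto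
  then have "((\<lambda>x. sqrt (V x)) \<longlongrightarrow> 0) (at 1)" by simp
  \<comment> \<open>The sign in \<open>h\<close> jumps at \<open>1\<close>, so continuity is read
    off the absolute value.\<close>
  then have "((\<lambda>x. \<bar>h x\<bar>) \<longlongrightarrow> 0) (at 1)"
    by (rule Lim_transform_eventually)
      (use eventually_pos_ne_1 V_nonneg in \<open>auto elim!: eventually_mono simp: h_def abs_mult abs_sgn_eq\<close>)
  then show ?thesis
    by (simp only: isCont_def h_1 tendsto_rabs_zero_iff)
qed

text \<open>The square of \<open>H\<close> is \<open>V'^2 / (4 V)\<close>, whose limit follows from
  l'Hopital's rule; positivity of \<open>H\<close> selects the root.\<close>

lemma H_tendsto_1: "(H \<longlongrightarrow> H 1) (at 1)"
proof -
  have "((\<lambda>x. (V' x)\<^sup>2 / V x) \<longlongrightarrow> 2 * V'' 1) (at 1)"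
  proof (rule lhopital)
    show "((\<lambda>x. (V' x)\<^sup>2) \<longlongrightarrow> 0) (at 1)"
      using tendsto_power[OF DERIV_isCont[OF DERIV_V'[of 1], unfolded isCont_def], of 2] by simp
    show "(V \<longlongrightarrow> 0) (at 1)"
      using DERIV_isCont[OF DERIV_V[of 1], unfolded isCont_def] by simp
    show "\<forall>\<^sub>F x in at 1. V x \<noteq> 0"
      using eventually_pos_ne_1 by eventually_elim (use V_pos in force)
    show ev: "\<forall>\<^sub>F x in at 1. V' x \<noteq> 0"
      using eventually_pos_ne_1 by eventually_elim (use V'_sign in \<open>force simp: neq_iff\<close>)
    show "\<forall>\<^sub>F x in at 1. ((\<lambda>x. (V' x)\<^sup>2) has_real_derivative 2 * V' x * V'' x) (at x)"
      using eventually_pos_ne_1 by eventually_elim (auto intro!: derivative_eq_intros DERIV_V')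
    show "\<forall>\<^sub>F x in at 1. (V has_real_derivative V' x) (at x)"
      using eventually_pos_ne_1 by eventually_elim (simp add: DERIV_V)
    have "((\<lambda>x. 2 * V'' x) \<longlongrightarrow> 2 * V'' 1) (at 1)"
      unfolding V''_def by (intro tendsto_intros) auto
    then show "((\<lambda>x. 2 * V' x * V'' x / V' x) \<longlongrightarrow> 2 * V'' 1) (at 1)"
      by (rule Lim_transform_eventually) (use ev in \<open>auto elim!: eventually_mono\<close>)
  qed
  then have "((\<lambda>x. sqrt ((V' x)\<^sup>2 / V x / 4)) \<longlongrightarrow> sqrt (2 * V'' 1 / 4)) (at 1)"
    by (intro tendsto_intros) auto
  moreover have "sqrt (2 * V'' 1 / 4) = H 1" by (simp add: H_def)
  ultimately have "((\<lambda>x. sqrt ((V' x)\<^sup>2 / V x / 4)) \<longlongrightarrow> H 1) (at 1)" by (simp only:)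
  moreover have "eventually (\<lambda>x. sqrt ((V' x)\<^sup>2 / V x / 4) = H x) (at 1)"
    using eventually_pos_ne_1
  proof eventually_elim
    case (elim x)
    have "(V' x)\<^sup>2 = 4 * V x * (H x)\<^sup>2"
      using elim by (simp add: h_mult_H[symmetric] h_sq[symmetric] power_mult_distrib)
    then have "(V' x)\<^sup>2 / V x / 4 = (H x)\<^sup>2" using V_pos[of x] elim by simp
    then show ?case using H_pos[of x] elim by (simp add: real_sqrt_abs)
  qed
  ultimately show ?thesis by (rule Lim_transform_eventually)
qed

lemma DERIV_h:
  assumes "0 < x"
  shows "(h has_real_derivative H x) (at x)"
proof (cases "x = 1")
  case True
  have "eventually (\<lambda>x. (h has_real_derivative H x) (at x)) (at 1)"
    using eventually_pos_ne_1 by eventually_elim (simp add: DERIV_h_ne1)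
  then show ?thesis
    using DERIV_at_limit_of_deriv[OF isCont_h_1 _ H_tendsto_1] True by simp
qed (use assms DERIV_h_ne1 in simp)

lemma isCont_H:
  assumes "0 < x"
  shows "isCont H x"
proof (cases "x = 1")
  case False
  have "isCont (\<lambda>x. V' x / (2 * h x)) x"
    using False assms h_sign[of x]
    by (intro continuous_intros DERIV_isCont[OF DERIV_V'] DERIV_isCont[OF DERIV_h]) (cases "x < 1"; simp)+
  moreover have "eventually (\<lambda>y. V' y / (2 * h y) = H y) (nhds x)"
  proof -
    have "eventually (\<lambda>y. y \<in> - {1}) (nhds x)"
      using False by (intro eventually_nhds_in_open) auto
    then show ?thesis by eventually_elim (simp add: H_def)
  qed
  ultimately show ?thesis by (simp add: isCont_cong)
qed (use H_tendsto_1 in \<open>simp add: isCont_def\<close>)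

lemma h_strict_mono:
  assumes "0 < x" "x < y"
  shows "h x < h y"
proof (rule DERIV_pos_imp_increasing[OF assms(2)])
  fix z assume "x \<le> z"
  then show "\<exists>d. (h has_real_derivative d) (at z) \<and> 0 < d"
    using assms(1) DERIV_h[of z] H_pos[of z] by (intro exI[of _ "H z"]) auto
qed

lemma h_less_iff: "0 < x \<Longrightarrow> 0 < y \<Longrightarrow> h x < h y \<longleftrightarrow> x < y"
  using h_strict_mono[of x y] h_strict_mono[of y x] by (cases x y rule: linorder_cases) auto

lemma h_inj: "0 < x \<Longrightarrow> 0 < y \<Longrightarrow> h x = h y \<longleftrightarrow> x = y"
  using h_strict_mono[of x y] h_strict_mono[of y x] by (cases x y rule: linorder_cases) auto

lemma V_tendsto_0: "(V \<longlongrightarrow> Emax) (at_right 0)"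
proof -
  have "((\<lambda>x. x powr q / q - x powr p / p + Emax) \<longlongrightarrow> 0 powr q / q - 0 powr p / p + Emax) (at_right 0)"
    using p pq by (intro tendsto_intros tendsto_powr2)
      (auto simp: eventually_at_right_field intro!: exI[of _ "1 :: real"])
  then have "((\<lambda>x. x powr q / q - x powr p / p + Emax) \<longlongrightarrow> Emax) (at_right 0)" by simp
  moreover have "eventually (\<lambda>x. x powr q / q - x powr p / p + Emax = V x) (at_right 0)"
    using eventually_at_right_less[of "0::real"] by eventually_elim (simp add: V_pos_arg)
  ultimately show ?thesis by (rule Lim_transform_eventually)
qed

lemma V_less_Emax: "0 < x \<Longrightarrow> x \<le> 1 \<Longrightarrow> V x < Emax"
proof -
  assume x: "0 < x" "x \<le> 1"
  have "x powr q \<le> x powr p" using x pq by (intro powr_mono') auto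
  moreover have "x powr p / q < x powr p / p" using x p pq by (intro divide_strict_left_mono) auto
  ultimately have "x powr q / q < x powr p / p"
    using divide_right_mono[of "x powr q" "x powr p" q] p pq by linarith
  then show "V x < Emax" using x by (simp add: V_pos_arg)
qed

text \<open>Intermediate values between a point near \<open>0\<close>, where \<open>V\<close> is
  close to \<open>Emax\<close>, and a point above \<open>1\<close> where \<open>V\<close> equals
  \<open>Emax\<close>.\<close>

lemma ex_h:
  assumes "\<bar>u\<bar> < sqrt Emax"
  shows "\<exists>x>0. h x = u"
proof -
  have "\<bar>u\<bar>\<^sup>2 < (sqrt Emax)\<^sup>2" using assms by (intro power_strict_mono) auto
  then have u2: "u\<^sup>2 < Emax" using Emax_pos by simp
  have "eventually (\<lambda>x. u\<^sup>2 < V x \<and> x < 1 \<and> 0 < x) (at_right 0)"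
    using order_tendstoD(1)[OF V_tendsto_0 u2] eventually_at_right_real[OF zero_less_one]
    by eventually_elim auto
  then obtain a where a: "u\<^sup>2 < V a" "a < 1" "0 < a"
    using eventually_happens'[OF trivial_limit_at_right_real] by blast
  have "(h a)\<^sup>2 > u\<^sup>2" using a by (simp add: h_sq)
  then have "\<bar>u\<bar>\<^sup>2 < (- h a)\<^sup>2" by simp
  then have "\<bar>u\<bar> < - h a" by (rule power2_less_imp_less) (use h_sign(1)[of a] a in simp)
  then have ha: "h a < u" by linarith
  \<comment> \<open>\<open>b\<close> solves \<open>x powr q / q = x powr p / p\<close>, so that
    \<open>h b = sqrt Emax\<close>.\<close>
  define b where "b = (q / p) powr (1 / (q - p))"
  have b: "1 < b" unfolding b_def using p pq by (intro gr_one_powr) auto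
  have "b powr (q - p) = q / p" unfolding b_def using p pq by (simp add: powr_powr)
  then have "b powr q = b powr p * (q / p)" using b powr_add[of b p "q - p"] by simp
  then have "V b = Emax" using b p pq by (simp add: V_pos_arg)
  then have hb: "u < h b" using b assms by (simp add: h_def)
  have "\<exists>x. a \<le> x \<and> x \<le> b \<and> h x = u"
    by (rule IVT) (use ha hb a b in \<open>auto intro!: DERIV_isCont[OF DERIV_h]\<close>)
  then obtain x where "a \<le> x" "h x = u" by blast
  then show ?thesis using a by (intro exI[of _ x]) auto
qed

text \<open>The inverse of \<open>h\<close>, used for \<open>\<bar>u\<bar> < sqrt Emax\<close>; this
  range contains every \<open>r * sin \<theta>\<close> of an admissible energy.\<close>

definition g :: "real \<Rightarrow> real" where "g u = (THE x. 0 < x \<and> h x = u)"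

lemma g_h [simp]: "0 < x \<Longrightarrow> g (h x) = x"
  unfolding g_def by (rule the_equality) (auto simp: h_inj)

lemma g_pos: "\<bar>u\<bar> < sqrt Emax \<Longrightarrow> 0 < g u"
  and h_g: "\<bar>u\<bar> < sqrt Emax \<Longrightarrow> h (g u) = u"
proof -
  assume "\<bar>u\<bar> < sqrt Emax"
  then obtain x where "0 < x" "h x = u" using ex_h by blast
  then show "0 < g u" "h (g u) = u" using g_h[of x] by simp_all
qed

text \<open>A monotone function with open image is continuous; here the image is a sublevel set of
  \<open>V\<close>.\<close>

lemma isCont_g:
  assumes "\<bar>u\<bar> < sqrt Emax"
  shows "isCont g u"
proof -
  have "continuous_on {- sqrt Emax<..<sqrt Emax} g"
  proof (rule continuous_onI_mono)
    have "g ` {- sqrt Emax<..<sqrt Emax} = {x. 0 < x \<and> V x < Emax}"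
    proof safe
      fix u assume "u \<in> {- sqrt Emax<..<sqrt Emax}"
      then have u: "\<bar>u\<bar> < sqrt Emax" by auto
      show "0 < g u" using g_pos[OF u] .
      have "V (g u) = \<bar>u\<bar>\<^sup>2" using h_sq[OF g_pos[OF u]] h_g[OF u] by simp
      also have "\<dots> < (sqrt Emax)\<^sup>2" using u by (intro power_strict_mono) auto
      finally show "V (g u) < Emax" using Emax_pos by simp
    next
      fix x assume x: "0 < x" "V x < Emax"
      have "\<bar>h x\<bar> = sqrt (V x)" using h_sq[of x] x by (simp flip: real_sqrt_abs)
      then have "\<bar>h x\<bar> < sqrt Emax" using x by simp
      then show "x \<in> g ` {- sqrt Emax<..<sqrt Emax}"
        using x by (intro image_eqI[of _ _ "h x"]) auto
    qed
    moreover have "open ({0<..} \<inter> V -` {..<Emax})"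
      by (intro continuous_open_preimage continuous_on_V) auto
    ultimately show "open (g ` {- sqrt Emax<..<sqrt Emax})"
      by (simp add: Int_def vimage_def greaterThan_def)
    fix x y assume "x \<in> {- sqrt Emax<..<sqrt Emax}" "y \<in> {- sqrt Emax<..<sqrt Emax}" "x \<le> y"
    then have "\<bar>x\<bar> < sqrt Emax" "\<bar>y\<bar> < sqrt Emax" "x \<le> y" by auto
    then show "g x \<le> g y" using h_less_iff[of "g y" "g x"] by (simp add: g_pos h_g flip: not_less)
  qed
  then show ?thesis using assms by (simp add: continuous_on_eq_continuous_at abs_less_iff minus_less_iff)
qed

lemma DERIV_g:
  assumes "\<bar>u\<bar> < sqrt Emax"
  shows "(g has_real_derivative 1 / H (g u)) (at u)"
proof (rule DERIV_compose_cancel[OF isCont_g[OF assms] DERIV_h[OF g_pos[OF assms]]])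
  show "H (g u) \<noteq> 0" using H_pos[OF g_pos[OF assms]] by simp
  have "eventually (\<lambda>s. s = h (g s)) (nhds u)"
    using eventually_nhds_in_open[of "{- sqrt Emax<..<sqrt Emax}" u] assms
    by (auto elim!: eventually_mono simp: h_g abs_less_iff)
  then show "((\<lambda>s. h (g s)) has_real_derivative 1) (at u)"
    using DERIV_cong_ev[of u u "\<lambda>s. s" "\<lambda>s. h (g s)" 1 1] by simp
qed

end

section \<open>The orbit of a given energy\<close>

context plaplace
begin

text \<open>At energy \<open>E\<close> the speed at position \<open>w\<close> is
  \<open>a * (E - V w) powr (1 / p)\<close>.\<close>

definition a :: real where "a = conjugate_exponent p powr (1 / p)"

lemma conj_pos: "0 < conjugate_exponent p"
  using p by (simp add: conjugate_exponent_def)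

lemma a_pos: "0 < a" and a_powr: "a powr p = conjugate_exponent p"
  using conj_pos p by (simp_all add: a_def powr_powr)

lemma signed_pow_eq_spow: "signed_pow p x = spow (p - 1) x"
proof (cases "x = 0")
  case False
  have "\<bar>x\<bar> powr (p - 1) = \<bar>x\<bar> powr (p - 2) * \<bar>x\<bar>"
    using False powr_add[of "\<bar>x\<bar>" "p - 2" 1] by simp
  then show ?thesis by (simp add: signed_pow_def spow_def mult_ac) (simp add: sgn_if)
qed (simp add: signed_pow_def)

lemma signed_pow_V': "0 < x \<Longrightarrow> signed_pow q x - signed_pow p x = V' x"
  using powr_add[of x "p - 2" 1] powr_add[of x "q - 2" 1] by (simp add: signed_pow_def V'_def)

end

locale orbit = plaplace +
  fixes E :: real
  assumes E_pos: "0 < E" and E_less: "E < max_energy p q"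
begin

section \<open>The angle on the orbit and the time it takes\<close>

definition r :: real where "r = sqrt E"

lemma r_pos: "0 < r" and r_less: "r < sqrt Emax" and r_sq: "r\<^sup>2 = E"
  using E_pos E_less by (simp_all add: r_def)

text \<open>The position at angle \<open>\<theta>\<close>; the sign of \<open>sin \<theta>\<close>
  decides the side of \<open>1\<close>.\<close>

definition \<gamma> :: "real \<Rightarrow> real" where "\<gamma> \<theta> = g (r * sin \<theta>)"

lemma in_chart: "\<bar>r * sin \<theta>\<bar> < sqrt Emax"
proof -
  have "\<bar>r * sin \<theta>\<bar> \<le> r" using r_pos by (simp add: abs_mult)
  then show ?thesis using r_less by linarith
qed

lemma \<gamma>_pos: "0 < \<gamma> \<theta>" and h_\<gamma>: "h (\<gamma> \<theta>) = r * sin \<theta>"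
  using g_pos[OF in_chart] h_g[OF in_chart] by (simp_all add: \<gamma>_def)

lemma DERIV_\<gamma>: "(\<gamma> has_real_derivative r * cos \<theta> / H (\<gamma> \<theta>)) (at \<theta>)"
proof -
  have "((\<lambda>\<theta>. r * sin \<theta>) has_real_derivative r * cos \<theta>) (at \<theta>)"
    by (auto intro!: derivative_eq_intros)
  from DERIV_chain2[OF DERIV_g[OF in_chart] this] show ?thesis
    by (simp add: \<gamma>_def[abs_def])
qed

text \<open>The derivative \<open>r * cos \<theta> / H (\<gamma> \<theta>)\<close> of the position
  divided by the speed \<open>a * \<bar>r * cos \<theta>\<bar> powr (2 / p)\<close>, in absolute
  value. Since \<open>2 / p < 1\<close>, it vanishes at the turning points instead of blowing
  up.\<close>

definition k :: "real \<Rightarrow> real" where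
  "k \<theta> = \<bar>r * cos \<theta>\<bar> powr (1 - 2 / p) / (a * H (\<gamma> \<theta>))"

text \<open>Time as a function of the angle. The additive constant left open by the choice only
  moves the time origin.\<close>

definition K :: "real \<Rightarrow> real" where
  "K = (SOME F. \<forall>x. (F has_real_derivative k x) (at x))"

lemma continuous_k: "continuous_on UNIV k"
proof -
  have "continuous_on UNIV (\<lambda>\<theta>. H (\<gamma> \<theta>))"
    using isCont_o2[OF DERIV_isCont[OF DERIV_\<gamma>] isCont_H[OF \<gamma>_pos]]
    by (simp add: continuous_on_eq_continuous_at)
  moreover have "continuous_on UNIV (\<lambda>\<theta>. \<bar>r * cos \<theta>\<bar> powr (1 - 2 / p))"
    using p by (intro continuous_on_powr' continuous_intros) auto
  moreover have "a * H (\<gamma> \<theta>) \<noteq> 0" for \<theta>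
    using a_pos H_pos[OF \<gamma>_pos] by (metis less_irrefl mult_pos_pos)
  ultimately show ?thesis
    unfolding k_def by (intro continuous_on_divide continuous_on_mult continuous_on_const) auto
qed

lemma DERIV_K: "(K has_real_derivative k x) (at x)"
proof -
  obtain F where "\<And>x. (F has_real_derivative k x) (at x)"
    using antiderivative_on_UNIV[OF continuous_k] by blast
  then have "\<exists>F. \<forall>x. (F has_real_derivative k x) (at x)" by blast
  then have "\<forall>x. (K has_real_derivative k x) (at x)" unfolding K_def by (rule someI_ex)
  then show ?thesis by blast
qed

lemma k_nonneg: "0 \<le> k \<theta>" and k_pos_iff: "0 < k \<theta> \<longleftrightarrow> cos \<theta> \<noteq> 0"
  using a_pos H_pos[OF \<gamma>_pos[of \<theta>]] r_pos by (auto simp: k_def zero_less_divide_iff)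

lemma k_periodic: "k (\<theta> + 2 * pi) = k \<theta>" and k_reflect: "k (pi - \<theta>) = k \<theta>"
  by (simp_all add: k_def \<gamma>_def cos_diff)

lemma cos_nonconstant:
  assumes "x < y" shows "\<exists>z. x < z \<and> z < y \<and> cos z \<noteq> (0 :: real)"
proof (rule ccontr)
  assume *: "\<not> ?thesis"
  define m where "m = (x + y) / 2"
  have c: "cos z = 0" if "\<bar>m - z\<bar> < (y - x) / 2" for z
    using * that by (auto simp: m_def abs_less_iff field_simps)
  have "- sin m = 0"
    by (rule DERIV_local_const[OF DERIV_cos, of "(y - x) / 2"]) (use assms c in auto)
  moreover have "cos m = 0" using c assms by auto
  ultimately show False using sin_zero_norm_cos_one by fastforce
qed

text \<open>The density \<open>k\<close> is nonnegative, and its zeros, those of the cosine, contain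
  no interval.\<close>

lemma K_strict_mono: "strict_mono K"
proof (rule strict_monoI)
  fix x y :: real assume xy: "x < y"
  have mono: "K u \<le> K v" if "u \<le> v" for u v
    using DERIV_K k_nonneg by (intro DERIV_nonneg_imp_nondecreasing[OF that]) blast
  obtain z where z: "x < z" "z < y" "cos z \<noteq> 0" using cos_nonconstant[OF xy] by blast
  show "K x < K y"
  proof (rule ccontr)
    assume "\<not> K x < K y"
    then have const: "K u = K x" if "x \<le> u" "u \<le> y" for u
      using mono[of x u] mono[of u y] that by linarith
    have "k z = 0"
    proof (rule DERIV_local_const[OF DERIV_K])
      show "0 < min (z - x) (y - z)" using z by simp
      show "\<forall>u. \<bar>z - u\<bar> < min (z - x) (y - z) \<longrightarrow> K z = K u"
      proof (intro allI impI)
        fix u assume "\<bar>z - u\<bar> < min (z - x) (y - z)"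
        then have "x \<le> u" "u \<le> y" by (auto simp: abs_less_iff)
        then show "K z = K u" using const[of z] const[of u] z by linarith
      qed
    qed
    then show False using z k_pos_iff[of z] by simp
  qed
qed

lemma K_less_iff [simp]: "K x < K y \<longleftrightarrow> x < y" and K_le_iff [simp]: "K x \<le> K y \<longleftrightarrow> x \<le> y"
  and K_eq_iff [simp]: "K x = K y \<longleftrightarrow> x = y"
  using K_strict_mono by (simp_all add: strict_mono_less strict_mono_less_eq strict_mono_eq)

definition P :: real where "P = K (2 * pi) - K 0"

lemma P_pos: "0 < P"
  by (simp add: P_def)

lemma K_shift: "K (\<theta> + 2 * pi) = K \<theta> + P"
proof -
  have "((\<lambda>\<theta>. K (\<theta> + 2 * pi) - K \<theta>) has_real_derivative 0) (at x)" for x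
    using k_periodic[of x] by (auto intro!: derivative_eq_intros DERIV_chain2[OF DERIV_K] DERIV_K)
  then have "K (\<theta> + 2 * pi) - K \<theta> = K (0 + 2 * pi) - K 0"
    by (intro DERIV_isconst_all) blast
  then show ?thesis by (simp add: P_def)
qed

text \<open>The reflection of \<open>\<theta>\<close> to \<open>pi - \<theta>\<close> preserves
  \<open>k\<close>, so climbing and descending take equal time.\<close>

lemma P_half: "P = 2 * (K (pi / 2) - K (- (pi / 2)))"
proof -
  have "((\<lambda>\<theta>. K (pi - \<theta>) + K \<theta>) has_real_derivative 0) (at x)" for x
    using k_reflect[of x] by (auto intro!: derivative_eq_intros DERIV_chain2[OF DERIV_K] DERIV_K)
  then have "K (pi - (- (pi / 2))) + K (- (pi / 2)) = K (pi - pi / 2) + K (pi / 2)"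
    by (intro DERIV_isconst_all) blast
  moreover have "pi - (- (pi / 2)) = - (pi / 2) + 2 * pi" "pi - pi / 2 = pi / 2" by simp_all
  ultimately show ?thesis using K_shift[of "- (pi / 2)"] by simp
qed

lemma K_shift_nat: "K (\<theta> + 2 * pi * real n) = K \<theta> + P * real n"
proof (induction n)
  case (Suc n)
  then show ?case using K_shift[of "\<theta> + 2 * pi * real n"] by (simp add: algebra_simps)
qed simp

text \<open>Each turn adds \<open>P > 0\<close>, so \<open>K\<close> is unbounded in both
  directions.\<close>

lemma surj_K: "\<exists>\<theta>. K \<theta> = t"
proof -
  obtain n where n: "\<bar>t - K 0\<bar> / P < real n" using reals_Archimedean2 by blast
  then have "\<bar>t - K 0\<bar> < P * real n" using P_pos by (simp add: divide_less_eq mult.commute)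
  then have "K (- 2 * pi * real n) \<le> t" "t \<le> K (2 * pi * real n)"
    using K_shift_nat[of 0 n] K_shift_nat[of "- 2 * pi * real n" n] by (auto simp: abs_less_iff)
  then have "\<exists>\<theta>. - 2 * pi * real n \<le> \<theta> \<and> \<theta> \<le> 2 * pi * real n \<and> K \<theta> = t"
    by (intro IVT) (auto intro!: DERIV_isCont[OF DERIV_K] simp: mult_nonneg_nonneg)
  then show ?thesis by blast
qed

definition \<Theta> :: "real \<Rightarrow> real" where "\<Theta> t = (THE \<theta>. K \<theta> = t)"

lemma \<Theta>_K [simp]: "\<Theta> (K \<theta>) = \<theta>"
  unfolding \<Theta>_def by (rule the_equality) auto

lemma K_\<Theta> [simp]: "K (\<Theta> t) = t"
  using surj_K[of t] by auto

lemma isCont_\<Theta>: "isCont \<Theta> t"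
proof -
  have "surj \<Theta>" using \<Theta>_K by (metis surjI)
  then have "continuous_on UNIV \<Theta>"
  proof (intro continuous_onI_mono)
    show "\<Theta> x \<le> \<Theta> y" if "x \<le> y" for x y
      using that K_le_iff[of "\<Theta> x" "\<Theta> y"] by simp
  qed simp
  then show ?thesis by (simp add: continuous_on_eq_continuous_at)
qed

lemma \<Theta>_eq_iff [simp]: "\<Theta> s = \<Theta> t \<longleftrightarrow> s = t"
  by (metis K_\<Theta>)

lemma \<Theta>_shift: "\<Theta> (t + P) = \<Theta> t + 2 * pi"
  using K_shift[of "\<Theta> t"] by (metis K_\<Theta> \<Theta>_K)

text \<open>Turning times are isolated. The density vanishes there, so \<open>\<Theta>\<close> has
  no finite derivative and the chain rule is confined to the other times.\<close>

lemma eventually_cos_\<Theta>: "eventually (\<lambda>s. cos (\<Theta> s) \<noteq> 0) (at t)"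
proof (cases "cos (\<Theta> t) = 0")
  case True
  then have "sin (\<Theta> t) \<noteq> 0" using sin_zero_norm_cos_one by fastforce
  then have "eventually (\<lambda>x. cos x \<noteq> cos (\<Theta> t)) (at (\<Theta> t))"
    by (intro DERIV_nonzero_eventually_ne[OF DERIV_cos]) simp
  moreover have "filterlim \<Theta> (at (\<Theta> t)) (at t)"
    using isCont_\<Theta>[of t] by (auto simp: filterlim_at isCont_def eventually_at_filter)
  ultimately show ?thesis using True by (auto dest: eventually_compose_filterlim)
next
  case False
  have "((\<lambda>s. cos (\<Theta> s)) \<longlongrightarrow> cos (\<Theta> t)) (at t)"
    using isCont_\<Theta>[of t] unfolding isCont_def by (intro tendsto_intros)
  then show ?thesis using False by (rule tendsto_imp_eventually_ne)
qed

lemma DERIV_\<Theta>: "cos (\<Theta> t) \<noteq> 0 \<Longrightarrow> (\<Theta> has_real_derivative 1 / k (\<Theta> t)) (at t)"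
  by (rule DERIV_compose_cancel[OF isCont_\<Theta> DERIV_K]) (use k_pos_iff[of "\<Theta> t"] in auto)

text \<open>The derivative of the position by the angle, divided by that of time, is the
  velocity.\<close>

lemma speed_identity:
  assumes "cos \<theta> \<noteq> 0"
  shows "r * cos \<theta> / H (\<gamma> \<theta>) / k \<theta> = a * spow (2 / p) (r * cos \<theta>)"
proof -
  define x where "x = r * cos \<theta>"
  have x: "x \<noteq> 0" using assms r_pos by (simp add: x_def)
  have "\<bar>x\<bar> powr (1 - 2 / p) * \<bar>x\<bar> powr (2 / p) = \<bar>x\<bar>"
    using x by (simp flip: powr_add)
  then have "x = spow (2 / p) x * \<bar>x\<bar> powr (1 - 2 / p)"
    by (simp add: spow_def mult_ac) (simp add: sgn_if)
  then have "x / \<bar>x\<bar> powr (1 - 2 / p) = spow (2 / p) x"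
    using x by (simp add: field_simps)
  moreover have "x / H (\<gamma> \<theta>) / k \<theta> = a * (x / \<bar>x\<bar> powr (1 - 2 / p))"
    using H_pos[OF \<gamma>_pos[of \<theta>]] by (simp add: k_def flip: x_def)
  ultimately show ?thesis by (simp add: x_def)
qed

section \<open>The solution obtained from the angle\<close>

definition w :: "real \<Rightarrow> real" where "w t = \<gamma> (\<Theta> t)"
definition w' :: "real \<Rightarrow> real" where "w' t = a * spow (2 / p) (r * cos (\<Theta> t))"

lemma w_pos: "0 < w t" and h_w: "h (w t) = r * sin (\<Theta> t)"
  by (simp_all add: w_def \<gamma>_pos h_\<gamma>)

lemma isCont_w: "isCont w t"
  unfolding w_def[abs_def] by (rule isCont_o2[OF isCont_\<Theta> DERIV_isCont[OF DERIV_\<gamma>]])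

lemma isCont_w': "isCont w' t"
  unfolding w'_def[abs_def] using p
  by (intro continuous_intros isCont_o2[OF _ isCont_spow] isCont_\<Theta>) auto

text \<open>The chain rule holds off the turning times, and continuity of \<open>w'\<close> fills
  them in. The flux is treated in the same way.\<close>

lemma DERIV_w: "(w has_real_derivative w' t) (at t)"
proof (rule DERIV_at_limit_of_deriv)
  show "isCont w t" by (rule isCont_w)
  show "(w' \<longlongrightarrow> w' t) (at t)" using isCont_w' by (simp add: isCont_def)
  show "eventually (\<lambda>s. (w has_real_derivative w' s) (at s)) (at t)"
    using eventually_cos_\<Theta>
  proof eventually_elim
    case (elim s)
    from DERIV_chain2[OF DERIV_\<gamma> DERIV_\<Theta>[OF elim]] show ?case
      using speed_identity[OF elim] by (simp add: w_def[abs_def] w'_def)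
  qed
qed

definition flux :: "real \<Rightarrow> real" where
  "flux t = a powr (p - 1) * spow (2 * (p - 1) / p) (r * cos (\<Theta> t))"

lemma flux_eq: "signed_pow p (w' t) = flux t"
  using a_pos by (simp add: signed_pow_eq_spow w'_def flux_def spow_mult spow_spow spow_pos)

lemma isCont_flux: "isCont flux t"
  unfolding flux_def[abs_def] using p
  by (intro continuous_intros isCont_o2[OF _ isCont_spow] isCont_\<Theta>) auto

lemma DERIV_flux: "(flux has_real_derivative - V' (w t)) (at t)"
proof (rule DERIV_at_limit_of_deriv)
  show "isCont flux t" by (rule isCont_flux)
  show "((\<lambda>t. - V' (w t)) \<longlongrightarrow> - V' (w t)) (at t)"
    using isCont_o2[OF isCont_w DERIV_isCont[OF DERIV_V'[OF w_pos]]]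
    by (intro tendsto_intros) (simp add: isCont_def)
  show "eventually (\<lambda>s. (flux has_real_derivative - V' (w s)) (at s)) (at t)"
    using eventually_cos_\<Theta>
  proof eventually_elim
    case (elim s)
    let ?\<theta> = "\<Theta> s" and ?b = "2 * (p - 1) / p"
    have nz: "r * cos ?\<theta> \<noteq> 0" using elim r_pos by simp
    have "((\<lambda>t. r * cos (\<Theta> t)) has_real_derivative r * (- sin ?\<theta> * (1 / k ?\<theta>))) (at s)"
      by (rule DERIV_cmult) (rule DERIV_chain2[OF DERIV_cos DERIV_\<Theta>[OF elim]])
    from DERIV_cmult[OF DERIV_chain2[OF DERIV_spow[OF nz] this], of "a powr (p - 1)" ?b]
    have "(flux has_real_derivative a powr (p - 1) * (?b * \<bar>r * cos ?\<theta>\<bar> powr (?b - 1) * (r * (- sin ?\<theta> * (1 / k ?\<theta>))))) (at s)"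
      by (simp add: flux_def[abs_def])
    moreover have "a powr (p - 1) * (?b * \<bar>r * cos ?\<theta>\<bar> powr (?b - 1) * (r * (- sin ?\<theta> * (1 / k ?\<theta>)))) = - V' (w s)"
    proof -
      \<comment> \<open>With this exponent the power of the cosine cancels against
        \<open>1 / k\<close>. As \<open>a powr p = p / (p - 1)\<close>, the constant becomes 2, and
        \<open>2 * h * H = V'\<close>.\<close>
      have b: "?b - 1 = 1 - 2 / p" using p by (simp add: field_simps)
      have pw: "\<bar>r * cos ?\<theta>\<bar> powr (1 - 2 / p) \<noteq> 0" using nz by simp
      have ap: "a powr (p - 1) * a = conjugate_exponent p"
        using a_pos powr_add[of a "p - 1" 1] a_powr by simp
      have "a powr (p - 1) * (?b * \<bar>r * cos ?\<theta>\<bar> powr (?b - 1) * (r * (- sin ?\<theta> * (1 / k ?\<theta>))))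
        = - ((a powr (p - 1) * a) * ?b * (r * sin ?\<theta>) * H (\<gamma> ?\<theta>))"
        unfolding b k_def using pw a_pos H_pos[OF \<gamma>_pos[of ?\<theta>]] by simp
      also have "\<dots> = - (2 * h (w s) * H (w s))"
        unfolding ap using p by (simp add: h_w conjugate_exponent_def w_def[symmetric] divide_simps)
      finally show ?thesis by (simp add: h_mult_H w_pos)
    qed
    ultimately show ?case by simp
  qed
qed

section \<open>Uniqueness up to translation and the minimal period\<close>

definition solution :: "(real \<Rightarrow> real) \<Rightarrow> bool" where
  "solution u \<longleftrightarrow> plaplace_solution p q u \<and> (\<forall>t. 0 < u t) \<and> has_energy p q u E"

lemma solution_w: "solution w"
proof -
  have dw: "deriv w t = w' t" for t by (rule DERIV_imp_deriv[OF DERIV_w])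
  have fl: "(\<lambda>s. signed_pow p (deriv w s)) = flux" by (simp add: dw flux_eq)
  have "plaplace_solution p q w"
    unfolding plaplace_solution_def fl
    using DERIV_w DERIV_flux DERIV_imp_deriv[OF DERIV_flux] signed_pow_V'[OF w_pos]
    by (auto simp: real_differentiable_def algebra_simps)
  moreover have "1 / conjugate_exponent p * \<bar>deriv w t\<bar> powr p + V (w t) = E" for t
  proof -
    have "\<bar>deriv w t\<bar> powr p = conjugate_exponent p * (r * cos (\<Theta> t))\<^sup>2"
      using a_pos p by (simp add: dw w'_def abs_mult powr_mult powr_powr a_powr)
        (simp add: power_mult_distrib)
    moreover have "V (w t) = (r * sin (\<Theta> t))\<^sup>2"
      using h_sq[OF w_pos] by (simp add: h_w)
    moreover have "(r * cos (\<Theta> t))\<^sup>2 + (r * sin (\<Theta> t))\<^sup>2 = E"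
      by (simp add: power_mult_distrib r_sq flip: distrib_left)
    ultimately show ?thesis using conj_pos by simp
  qed
  ultimately show ?thesis using w_pos by (simp add: solution_def has_energy_def)
qed


text \<open>Conservation of energy puts \<open>(X, Y)\<close> on the unit circle. The lifted angle
  moves with velocity \<open>1 / k\<close>, so \<open>K (\<theta> t) - t\<close> is constant and
  \<open>u\<close> is \<open>w\<close> up to a time shift.\<close>

lemma solution_translate:
  assumes "solution u"
  obtains c where "\<And>t. u t = w (t + c)"
proof -
  define u' y where "u' = deriv u" and "y t = signed_pow p (u' t)" for t
  have pos: "0 < u t" and en: "1 / conjugate_exponent p * \<bar>u' t\<bar> powr p + V (u t) = E" for t
    using assms by (auto simp: solution_def has_energy_def u'_def)
  have du: "(u has_real_derivative u' t) (at t)" for t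
    using assms unfolding solution_def plaplace_solution_def u'_def
    by (auto simp: real_differentiable_def dest!: spec[of _ t] dest: DERIV_imp_deriv)
  have dy: "(y has_real_derivative - V' (u t)) (at t)" for t
  proof -
    have eq: "deriv y t + signed_pow q (u t) - signed_pow p (u t) = 0" and "y differentiable at t"
      using assms unfolding solution_def plaplace_solution_def u'_def y_def[abs_def] by auto
    then have "(y has_real_derivative deriv y t) (at t)"
      by (simp add: DERIV_deriv_iff_real_differentiable)
    moreover have "deriv y t = - V' (u t)" using eq signed_pow_V'[OF pos, of t] by simp
    ultimately show ?thesis by simp
  qed
  have u'y: "u' t = spow (1 / (p - 1)) (y t)" for t
    using p by (simp add: y_def signed_pow_eq_spow spow_spow)
  \<comment> \<open>Only the flux \<open>y\<close> is known to be differentiable; \<open>u'\<close>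
    is a continuous root of it.\<close>
  have cu': "continuous_on UNIV u'"
  proof -
    have "continuous_on UNIV (\<lambda>t. spow (1 / (p - 1)) (y t))"
      using p by (intro continuous_on_spow continuous_at_imp_continuous_on ballI DERIV_isCont[OF dy]) auto
    then show ?thesis by (simp flip: u'y)
  qed
  \<comment> \<open>The signed roots of the kinetic and the potential energy, divided by
    \<open>r\<close>.\<close>
  define X Y where "X t = spow (p / 2) (u' t / a) / r" and "Y t = h (u t) / r" for t
  have "continuous_on UNIV X"
    unfolding X_def using p r_pos a_pos by (intro continuous_intros cu') auto
  moreover have "continuous_on UNIV Y"
    unfolding Y_def using r_pos isCont_o2[OF DERIV_isCont[OF du] DERIV_isCont[OF DERIV_h[OF pos]]]
    by (intro continuous_intros continuous_at_imp_continuous_on ballI) auto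
  moreover have "(X t)\<^sup>2 + (Y t)\<^sup>2 = 1" for t
  proof -
    have "(spow (p / 2) (u' t / a))\<^sup>2 = (\<bar>u' t / a\<bar> powr (p / 2))\<^sup>2"
      by (metis abs_spow power2_abs)
    also have "\<dots> = \<bar>u' t / a\<bar> powr p" by (simp flip: powr_add add: power2_eq_square)
    also have "\<dots> = \<bar>u' t\<bar> powr p / conjugate_exponent p"
      using a_pos by (simp add: powr_divide a_powr)
    finally have "(spow (p / 2) (u' t / a))\<^sup>2 + (h (u t))\<^sup>2 = E"
      using en[of t] by (simp add: h_sq pos)
    then show ?thesis
      using E_pos by (simp add: X_def Y_def power_divide r_sq flip: add_divide_distrib)
  qed
  ultimately obtain \<theta> where \<theta>: "continuous_on UNIV \<theta>" "\<And>t. X t = cos (\<theta> t)" "\<And>t. Y t = sin (\<theta> t)"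
    by (rule angle_lift) blast
  have c\<theta>: "isCont \<theta> t" for t using \<theta>(1) by (simp add: continuous_on_eq_continuous_at)
  have hu: "h (u t) = r * sin (\<theta> t)" for t
    using \<theta>(3)[of t] r_pos by (simp add: Y_def field_simps)
  have u\<gamma>: "u t = \<gamma> (\<theta> t)" for t by (simp add: \<gamma>_def flip: hu) (simp add: pos)
  have "r * cos (\<theta> t) = spow (p / 2) (u' t / a)" for t
    using \<theta>(2)[of t] r_pos by (simp add: X_def field_simps)
  then have u': "u' t = a * spow (2 / p) (r * cos (\<theta> t))" for t
    using p a_pos by (simp add: spow_spow)
  have d\<theta>: "(\<theta> has_real_derivative 1 / k (\<theta> t)) (at t)" if nz: "cos (\<theta> t) \<noteq> 0" for t
  proof -
    have "((\<lambda>s. sin (\<theta> s)) has_real_derivative H (u t) * u' t / r) (at t)"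
      using DERIV_cdivide[OF DERIV_chain2[OF DERIV_h[OF pos] du], of r t] by (simp add: \<theta>(3)[symmetric] Y_def)
    from DERIV_compose_cancel[OF c\<theta> DERIV_sin nz this]
    have "(\<theta> has_real_derivative H (u t) * u' t / r / cos (\<theta> t)) (at t)" .
    moreover have "H (u t) * u' t / r / cos (\<theta> t) = 1 / k (\<theta> t)"
      unfolding u' u\<gamma> using speed_identity[OF nz, symmetric] nz r_pos H_pos[OF \<gamma>_pos[of "\<theta> t"]] by simp
    ultimately show ?thesis by simp
  qed
  \<comment> \<open>At a turning time \<open>V (u t) = E > 0\<close>, so
    \<open>u t \<noteq> 1\<close> and the flux has the nonzero derivative \<open>- V' (u t)\<close>.
    It vanishes whenever \<open>cos (\<theta> s)\<close> does, so turning times are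
    isolated.\<close>
  have ev: "eventually (\<lambda>s. cos (\<theta> s) \<noteq> 0) (at t)" for t
  proof (cases "cos (\<theta> t) = 0")
    case True
    then have "u' t = 0" by (simp add: u')
    then have "V (u t) = E" "y t = 0" using en[of t] by (simp_all add: y_def signed_pow_def)
    then have "u t \<noteq> 1" using E_pos by auto
    then have "- V' (u t) \<noteq> 0" using V'_sign[of "u t"] pos[of t] by (cases "u t < 1") auto
    from DERIV_nonzero_eventually_ne[OF dy this] show ?thesis
    proof eventually_elim
      case (elim s)
      have "y s = 0" if "cos (\<theta> s) = 0" using that by (simp add: y_def u' signed_pow_def)
      with elim \<open>y t = 0\<close> show ?case by auto
    qed
  next
    case False
    have "((\<lambda>s. cos (\<theta> s)) \<longlongrightarrow> cos (\<theta> t)) (at t)"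
      using c\<theta>[of t] unfolding isCont_def by (intro tendsto_intros)
    then show ?thesis using False by (rule tendsto_imp_eventually_ne)
  qed
  have "((\<lambda>s. K (\<theta> s) - s) has_real_derivative 0) (at t)" for t
  proof (rule DERIV_at_limit_of_deriv)
    show "isCont (\<lambda>s. K (\<theta> s) - s) t"
      by (intro continuous_intros isCont_o2[OF c\<theta> DERIV_isCont[OF DERIV_K]])
    show "eventually (\<lambda>s. ((\<lambda>s. K (\<theta> s) - s) has_real_derivative 0) (at s)) (at t)"
      using ev
    proof eventually_elim
      case (elim s)
      have "((\<lambda>s. K (\<theta> s) - s) has_real_derivative k (\<theta> s) * (1 / k (\<theta> s)) - 1) (at s)"
        by (intro DERIV_diff DERIV_chain2[OF DERIV_K d\<theta>[OF elim]] DERIV_ident)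
      then show ?case using k_pos_iff[of "\<theta> s"] elim by simp
    qed
  qed simp
  then have *: "K (\<theta> t) - t = K (\<theta> 0) - 0" for t
    by (intro DERIV_isconst_all) blast
  have \<theta>\<Theta>: "\<theta> t = \<Theta> (t + K (\<theta> 0))" for t
  proof -
    have "K (\<theta> t) = t + K (\<theta> 0)" using *[of t] by simp
    with \<Theta>_K[of "\<theta> t"] show ?thesis by simp
  qed
  have "u t = w (t + K (\<theta> 0))" for t
    by (simp add: u\<gamma> w_def flip: \<theta>\<Theta>)
  then show thesis by (rule that)
qed

lemma is_period_w: "is_period w P"
  using P_pos by (simp add: is_period_def w_def \<Theta>_shift \<gamma>_def)

text \<open>At angle \<open>0\<close> the velocity takes its maximum, attained only at multiples of
  \<open>2 * pi\<close>. Returning to it at a later time requires at least one full turn.\<close>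

lemma is_period_w_ge:
  assumes "is_period w S"
  shows "P \<le> S"
proof -
  have S: "0 < S" "\<And>t. w (t + S) = w t" using assms by (auto simp: is_period_def)
  define t where "t = K 0"
  have "((\<lambda>t. w (t + S)) has_real_derivative w' (t + S)) (at t)"
    using DERIV_w[of "t + S"] by (simp add: DERIV_shift)
  then have "w' (t + S) = w' t"
    using DERIV_unique[OF _ DERIV_w[of t]] by (simp add: S(2))
  then have c: "cos (\<Theta> (t + S)) = 1"
    using a_pos r_pos p by (simp add: w'_def spow_inj t_def)
  then obtain n :: int where n: "\<Theta> (t + S) = real_of_int n * 2 * pi"
    using cos_one_2pi_int by auto
  have "K 0 < K (\<Theta> (t + S))" using S by (simp add: t_def)
  then have "0 < \<Theta> (t + S)" by (simp only: K_less_iff)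
  then have "1 \<le> n" by (simp add: n zero_less_mult_iff)
  then have "2 * pi \<le> \<Theta> (t + S)" by (simp add: n)
  then have "K (2 * pi) \<le> K (\<Theta> (t + S))" by (simp only: K_le_iff)
  then show ?thesis by (simp add: P_def t_def)
qed

text \<open>\<open>P\<close> is the minimal period of \<open>w\<close>, and every other admissible
  solution is a translate of \<open>w\<close> with the same periods.\<close>

lemma period_eq: "period p q E = P"
  unfolding period_def
proof (rule the_equality)
  have "is_minimal_period w P"
    using is_period_w is_period_w_ge by (simp add: is_minimal_period_def)
  then show "\<exists>w. plaplace_solution p q w \<and> (\<forall>t. 0 < w t) \<and> has_energy p q w E \<and> is_minimal_period w P"
    using solution_w by (auto simp: solution_def)
next
  fix T
  assume "\<exists>w. plaplace_solution p q w \<and> (\<forall>t. 0 < w t) \<and> has_energy p q w E \<and> is_minimal_period w T"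
  then obtain u where u: "solution u" "is_minimal_period u T" by (auto simp: solution_def)
  obtain c where c: "\<And>t. u t = w (t + c)" using solution_translate[OF u(1)] by blast
  have "is_period u S \<longleftrightarrow> is_period w S" for S
  proof
    assume "is_period w S"
    then have "0 < S" "w (t + c + S) = w (t + c)" for t by (simp_all add: is_period_def)
    then show "is_period u S" by (simp add: is_period_def c add_ac)
  next
    assume S: "is_period u S"
    have "w (t + S) = w t" for t
    proof -
      have "u (t - c + S) = u (t - c)" using S by (simp add: is_period_def)
      then show ?thesis by (simp add: c algebra_simps)
    qed
    then show "is_period w S" using S by (simp add: is_period_def)
  qed
  then show "T = P"
    using u(2) is_period_w is_period_w_ge by (auto simp: is_minimal_period_def intro: antisym)
qed

end

section \<open>Dependence of the period on the energy\<close>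

text \<open>The gain \<open>b' - b\<close> carries the larger weight and covers any loss in the
  other coefficient; strictness comes from \<open>n < n'\<close> and \<open>0 < b'\<close>.\<close>

lemma weighted_sum_less:
  fixes a b :: real
  assumes "a + b \<le> a' + b'" "b \<le> b'" "0 \<le> a'" "0 < b'"
    and "0 \<le> m" "m \<le> n" "m \<le> m'" "n < n'"
  shows "a * m + b * n < a' * m' + b' * n'"
proof -
  have "(b' - b) * m \<le> (b' - b) * n" using assms by (intro mult_left_mono) auto
  moreover have "0 \<le> (a' + b' - (a + b)) * m" using assms by simp
  ultimately have "a * m + b * n \<le> a' * m + b' * n" by (simp add: algebra_simps)
  also have "\<dots> \<le> a' * m' + b' * n" using assms by (intro add_right_mono mult_left_mono) auto
  also have "\<dots> < a' * m' + b' * n'" using assms by simp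
  finally show ?thesis .
qed

text \<open>The exponent for which \<open>z = w powr (p / 2)\<close> gives
  \<open>z powr Q = w powr q\<close>.\<close>

definition (in plaplace) Q :: real where "Q = 2 * q / p"

sublocale plaplace \<subseteq> osc: scaled_oscillator Q
  by unfold_locales (use p pq in \<open>simp add: Q_def field_simps\<close>)

context plaplace
begin

definition \<alpha> :: real where "\<alpha> = 1 - 2 / p"

lemma \<alpha>_pos: "0 < \<alpha>"
  using p by (simp add: \<alpha>_def)

lemma powr_half_\<alpha>: "(x powr (p / 2)) powr \<alpha> = x powr (p / 2 - 1)"
proof -
  have "p / 2 * \<alpha> = p / 2 - 1" using p by (simp add: \<alpha>_def field_simps)
  then show ?thesis by (simp only: powr_powr)
qed

lemma V_osc:
  assumes "0 < x"
  shows "V x = 2 / p * osc.v (x powr (p / 2))"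
proof -
  have "(x powr (p / 2)) powr Q = x powr q" using p by (simp add: powr_powr Q_def)
  moreover have "(x powr (p / 2))\<^sup>2 = x powr p" by (simp add: power2_eq_square flip: powr_add)
  ultimately have "osc.v (x powr (p / 2)) = x powr q / Q - x powr p / 2 + (1 / 2 - 1 / Q)"
    by (simp only: osc.v_def)
  then show ?thesis
    using assms p pq by (simp add: V_pos_arg max_energy_def Q_def) (simp add: field_simps)
qed

text \<open>The chain rule for \<open>V_osc\<close>: the derivative of \<open>x powr (p / 2)\<close>
  is \<open>p / 2\<close> times its own power with exponent \<open>\<alpha>\<close>.\<close>

lemma V'_osc:
  assumes "0 < x"
  shows "V' x = (x powr (p / 2)) powr \<alpha> * osc.v1 (x powr (p / 2))"
proof -
  have "p / 2 * (Q - 1) = q - p / 2" using p by (simp add: Q_def field_simps)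
  then have 2: "(x powr (p / 2)) powr (Q - 1) = x powr (q - p / 2)" by (simp only: powr_powr)
  have "x powr (p / 2 - 1) * x powr (q - p / 2) = x powr (q - 1)"
    "x powr (p / 2 - 1) * x powr (p / 2) = x powr (p - 1)"
    by (simp_all flip: powr_add)
  then show ?thesis by (simp only: V'_def osc.v1_def powr_half_\<alpha> 2 right_diff_distrib)
qed

definition \<zeta> :: "real \<Rightarrow> real" where "\<zeta> u = g u powr (p / 2)"

lemma \<zeta>_pos: "\<bar>u\<bar> < sqrt Emax \<Longrightarrow> 0 < \<zeta> u"
  using g_pos[of u] by (simp add: \<zeta>_def)

lemma g_0: "g 0 = 1"
  using g_h[of 1] by simp

lemma g_less_iff: "\<bar>u\<bar> < sqrt Emax \<Longrightarrow> \<bar>u'\<bar> < sqrt Emax \<Longrightarrow> g u < g u' \<longleftrightarrow> u < u'"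
  using h_less_iff[of "g u" "g u'"] by (simp add: g_pos h_g)

lemma \<zeta>_strict_mono:
  assumes "\<bar>u\<bar> < sqrt Emax" "\<bar>u'\<bar> < sqrt Emax" "u < u'"
  shows "\<zeta> u < \<zeta> u'"
  using assms g_less_iff[of u u'] g_pos[of u] p by (auto simp: \<zeta>_def intro!: powr_less_mono2)

lemma \<zeta>_0: "\<zeta> 0 = 1"
  by (simp add: \<zeta>_def g_0)

lemma v_\<zeta>:
  assumes "\<bar>u\<bar> < sqrt Emax"
  shows "u\<^sup>2 = 2 / p * osc.v (\<zeta> u)"
  using V_osc[OF g_pos[OF assms]] h_sq[OF g_pos[OF assms]] by (simp add: h_g assms \<zeta>_def)

text \<open>Solve \<open>2 * h * H = V'\<close> for \<open>H\<close>, using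
  \<open>u^2 = 2 / p * v\<close>. At \<open>u = 0\<close> the quotient \<open>N\<close>
  degenerates.\<close>

lemma inverse_H:
  assumes u: "\<bar>u\<bar> < sqrt Emax" "u \<noteq> 0"
  shows "1 / H (g u) = 2 * sqrt (2 / p) * \<zeta> u powr (- \<alpha>) * sqrt (osc.N (\<zeta> u))"
proof -
  have z: "0 < \<zeta> u" by (rule \<zeta>_pos) (rule u)
  have H0: "0 < H (g u)" by (rule H_pos[OF g_pos]) (rule u)
  have "2 * \<bar>u\<bar> * H (g u) = \<bar>2 * h (g u) * H (g u)\<bar>"
    using H0 by (simp add: h_g u abs_mult)
  also have "\<dots> = \<bar>V' (g u)\<bar>" by (simp only: h_mult_H[OF g_pos[OF u(1)]])
  also have "\<dots> = \<zeta> u powr \<alpha> * \<bar>osc.v1 (\<zeta> u)\<bar>"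
    using V'_osc[OF g_pos[OF u(1)]] by (simp add: \<zeta>_def abs_mult)
  finally have *: "2 * \<bar>u\<bar> * H (g u) = \<zeta> u powr \<alpha> * \<bar>osc.v1 (\<zeta> u)\<bar>" .
  then have v1: "\<bar>osc.v1 (\<zeta> u)\<bar> > 0" using u H0 by auto
  have "\<bar>u\<bar> = sqrt (2 / p * osc.v (\<zeta> u))" using v_\<zeta>[OF u(1)] by (metis real_sqrt_abs)
  then have "sqrt (2 / p) * sqrt (osc.N (\<zeta> u)) = \<bar>u\<bar> / \<bar>osc.v1 (\<zeta> u)\<bar>"
    by (simp add: osc.N_def real_sqrt_divide real_sqrt_mult)
  moreover have "1 / H (g u) = 2 * \<bar>u\<bar> / (\<zeta> u powr \<alpha> * \<bar>osc.v1 (\<zeta> u)\<bar>)"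
    using u H0 by (simp flip: *)
  ultimately show ?thesis by (simp add: powr_minus field_simps)
qed

lemma \<zeta>_ne_1: "\<bar>u\<bar> < sqrt Emax \<Longrightarrow> u \<noteq> 0 \<Longrightarrow> \<zeta> u \<noteq> 1"
  using \<zeta>_strict_mono[of u 0] \<zeta>_strict_mono[of 0 u] Emax_pos by (cases "u < 0") (auto simp: \<zeta>_0)

lemma N_pos: "\<bar>u\<bar> < sqrt Emax \<Longrightarrow> u \<noteq> 0 \<Longrightarrow> 0 < osc.N (\<zeta> u)"
  using osc.v_pos[OF \<zeta>_pos \<zeta>_ne_1, of u] osc.v1_sign[of "\<zeta> u"] \<zeta>_pos[of u] \<zeta>_ne_1[of u]
  by (cases "\<zeta> u < 1") (auto simp: osc.N_def)

text \<open>The derivative of \<open>\<zeta>\<close> contains a factor \<open>sqrt N\<close> that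
  cancels the one from the outer root. Thus the slope is a multiple of \<open>N'\<close> itself, to
  which convexity applies.\<close>

lemma DERIV_sqrt_N:
  assumes u: "\<bar>u\<bar> < sqrt Emax" "u \<noteq> 0"
  shows "((\<lambda>u. sqrt (osc.N (\<zeta> u))) has_real_derivative sqrt (p / 2) * osc.N' (\<zeta> u)) (at u)"
proof -
  have g0: "0 < g u" using g_pos u by blast
  have N: "0 < osc.N (\<zeta> u)" using N_pos u by blast
  have "g u powr (p / 2 - 1) = \<zeta> u powr \<alpha>"
    by (simp only: \<zeta>_def powr_half_\<alpha>)
  moreover have "(\<zeta> has_real_derivative p / 2 * g u powr (p / 2 - 1) * (1 / H (g u))) (at u)"
    unfolding \<zeta>_def[abs_def] using g0
    by (auto intro!: derivative_eq_intros DERIV_g u)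
  ultimately have "(\<zeta> has_real_derivative p * sqrt (2 / p) * sqrt (osc.N (\<zeta> u))) (at u)"
    using \<zeta>_pos[OF u(1)] unfolding inverse_H[OF u] by (simp add: powr_minus field_simps)
  from DERIV_chain2[OF osc.DERIV_N[OF \<zeta>_pos[OF u(1)] \<zeta>_ne_1[OF u]] this]
  have "((\<lambda>u. sqrt (osc.N (\<zeta> u))) has_real_derivative
      inverse (sqrt (osc.N (\<zeta> u))) / 2 * (osc.N' (\<zeta> u) * (p * sqrt (2 / p) * sqrt (osc.N (\<zeta> u))))) (at u)"
    by (rule DERIV_chain2[where f = sqrt and g = "\<lambda>u. osc.N (\<zeta> u)", OF DERIV_real_sqrt[OF N]])
  moreover have "inverse (sqrt (osc.N (\<zeta> u))) / 2 * (osc.N' (\<zeta> u) * (p * sqrt (2 / p) * sqrt (osc.N (\<zeta> u))))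
     = (p * sqrt (2 / p) / 2) * osc.N' (\<zeta> u)"
    using N by (simp add: field_simps)
  moreover have "p * sqrt (2 / p) / 2 = sqrt (p / 2)"
    using p by (simp add: real_sqrt_divide field_simps)
  ultimately show ?thesis by (simp only:)
qed

lemma DERIV_sqrt_N_minus:
  assumes u: "\<bar>u\<bar> < sqrt Emax" "u \<noteq> 0"
  shows "((\<lambda>u. sqrt (osc.N (\<zeta> (- u)))) has_real_derivative - sqrt (p / 2) * osc.N' (\<zeta> (- u))) (at u)"
proof -
  have "((\<lambda>u. sqrt (osc.N (\<zeta> u))) has_real_derivative sqrt (p / 2) * osc.N' (\<zeta> (- u))) (at (- u))"
    by (rule DERIV_sqrt_N) (use u in auto)
  from DERIV_chain2[OF this DERIV_minus[OF DERIV_ident]] show ?thesis by simp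
qed

text \<open>Since \<open>1 / H (g y)\<close> is the derivative of \<open>g\<close>, the sum collects
  the two points of equal potential \<open>y^2\<close>.\<close>

definition \<phi> :: "real \<Rightarrow> real" where "\<phi> y = y powr \<alpha> * (1 / H (g y) + 1 / H (g (- y)))"

lemma \<phi>_eq:
  assumes "0 < y" "y < sqrt Emax"
  shows "\<phi> y = 2 * sqrt (2 / p) *
    (sqrt (osc.N (\<zeta> y)) * (y / \<zeta> y) powr \<alpha> + sqrt (osc.N (\<zeta> (- y))) * (y / \<zeta> (- y)) powr \<alpha>)"
proof -
  have u: "\<bar>y\<bar> < sqrt Emax" "y \<noteq> 0" "\<bar>- y\<bar> < sqrt Emax" "- y \<noteq> 0" using assms by auto
  have e: "y powr \<alpha> * z powr (- \<alpha>) = (y / z) powr \<alpha>" if "0 < z" for z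
    using that assms by (simp add: powr_divide powr_minus_divide)
  show ?thesis
    unfolding \<phi>_def inverse_H[OF u(1,2)] inverse_H[OF u(3,4)]
      e[OF \<zeta>_pos[OF u(1)], symmetric] e[OF \<zeta>_pos[OF u(3)], symmetric]
    by (simp only: algebra_simps)
qed

lemma \<phi>_strict_mono:
  assumes xy: "0 < x" "x < y" "y < sqrt Emax"
  shows "\<phi> x < \<phi> y"
proof -
  let ?f = "\<lambda>u. sqrt (osc.N (\<zeta> u))"
  have in_dom: "\<bar>u\<bar> < sqrt Emax" "\<bar>- u\<bar> < sqrt Emax" "u \<noteq> 0" "- u \<noteq> 0" "\<zeta> (- u) < 1" "1 < \<zeta> u"
    "0 < \<zeta> (- u)" if "x \<le> u" "u \<le> y" for u
  proof -
    show *: "\<bar>u\<bar> < sqrt Emax" "\<bar>- u\<bar> < sqrt Emax" "u \<noteq> 0" "- u \<noteq> 0" using that xy by auto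
    show "\<zeta> (- u) < 1" "1 < \<zeta> u"
      using that xy Emax_pos \<zeta>_strict_mono[of "- u" 0] \<zeta>_strict_mono[of 0 u] by (auto simp: \<zeta>_0)
    show "0 < \<zeta> (- u)" using \<zeta>_pos * by blast
  qed
  note D = in_dom[of x] in_dom[of y]
  have p2: "0 \<le> sqrt (p / 2)" using p by simp
  \<comment> \<open>Up to a constant the slope of the sum is
    \<open>N' (\<zeta> u) - N' (\<zeta> (- u))\<close>, and the limit of \<open>N'\<close> at
    \<open>1\<close> lies between the two terms.\<close>
  have sum: "?f x + ?f (- x) \<le> ?f y + ?f (- y)"
  proof (rule DERIV_nonneg_imp_nondecreasing[where f = "\<lambda>u. ?f u + ?f (- u)"])
    fix u assume u: "x \<le> u" "u \<le> y"
    note * = in_dom[OF u]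
    have "osc.N' (\<zeta> (- u)) \<le> osc.N' (\<zeta> u)"
      using osc.N'_le_limit[of "\<zeta> (- u)"] osc.N'_ge_limit[of "\<zeta> u"] * by linarith
    then have "0 \<le> sqrt (p / 2) * osc.N' (\<zeta> u) + - sqrt (p / 2) * osc.N' (\<zeta> (- u))"
      using p2 by (simp add: mult_left_mono)
    then show "\<exists>d. ((\<lambda>u. ?f u + ?f (- u)) has_real_derivative d) (at u) \<and> 0 \<le> d"
      using DERIV_add[OF DERIV_sqrt_N[OF *(1,3)] DERIV_sqrt_N_minus[OF *(1,3)]] by blast
  qed (use xy in simp)
  \<comment> \<open>As \<open>u\<close> grows, \<open>\<zeta> (- u)\<close> falls within (0,1),
    where \<open>N\<close> is decreasing.\<close>
  have minus: "?f (- x) \<le> ?f (- y)"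
  proof (rule DERIV_nonneg_imp_nondecreasing[where f = "\<lambda>u. ?f (- u)"])
    fix u assume u: "x \<le> u" "u \<le> y"
    note * = in_dom[OF u]
    have "0 \<le> - sqrt (p / 2) * osc.N' (\<zeta> (- u))"
      using p2 osc.N'_neg[of "\<zeta> (- u)"] * by (simp add: mult_nonneg_nonpos)
    then show "\<exists>d. ((\<lambda>u. ?f (- u)) has_real_derivative d) (at u) \<and> 0 \<le> d"
      using DERIV_sqrt_N_minus[OF *(1,3)] by blast
  qed (use xy in simp)
  have "(x / \<zeta> x)\<^sup>2 = 2 / p * (osc.v (\<zeta> x) / (\<zeta> x)\<^sup>2)" "(y / \<zeta> y)\<^sup>2 = 2 / p * (osc.v (\<zeta> y) / (\<zeta> y)\<^sup>2)"
    using v_\<zeta>[of x] v_\<zeta>[of y] D xy by (simp_all add: power_divide)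
  moreover have "osc.v (\<zeta> x) / (\<zeta> x)\<^sup>2 \<le> osc.v (\<zeta> y) / (\<zeta> y)\<^sup>2"
    using D xy \<zeta>_strict_mono[of x y] by (intro osc.v_over_square_mono) auto
  ultimately have "(x / \<zeta> x)\<^sup>2 \<le> (y / \<zeta> y)\<^sup>2"
    using p by (simp only: mult_left_mono divide_nonneg_nonneg)
  then have ratio: "x / \<zeta> x \<le> y / \<zeta> y"
    by (rule power2_le_imp_le) (use D xy in simp)
  \<comment> \<open>On the lower branch the numerator grows and the denominator shrinks; this gives
    the strict inequality of the whole lemma.\<close>
  have "\<zeta> (- y) < \<zeta> (- x)" using D xy by (intro \<zeta>_strict_mono) auto
  then have ratio': "x / \<zeta> (- x) < y / \<zeta> (- y)"
    using D xy by (intro frac_less) auto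
  have ratio_le: "x / \<zeta> x \<le> x / \<zeta> (- x)"
    using D xy by (intro divide_left_mono) auto
  have "?f x * (x / \<zeta> x) powr \<alpha> + ?f (- x) * (x / \<zeta> (- x)) powr \<alpha>
      < ?f y * (y / \<zeta> y) powr \<alpha> + ?f (- y) * (y / \<zeta> (- y)) powr \<alpha>"
    using sum minus
  proof (rule weighted_sum_less)
    show "0 \<le> ?f y" "0 < ?f (- y)" using N_pos[of y] N_pos[of "- y"] D xy by auto
    show "(x / \<zeta> x) powr \<alpha> \<le> (x / \<zeta> (- x)) powr \<alpha>" "(x / \<zeta> x) powr \<alpha> \<le> (y / \<zeta> y) powr \<alpha>"
      "(x / \<zeta> (- x)) powr \<alpha> < (y / \<zeta> (- y)) powr \<alpha>"
      using ratio ratio' ratio_le \<alpha>_pos D xy by (auto intro!: powr_mono2 powr_less_mono2)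
  qed simp
  then show ?thesis using p xy by (simp add: \<phi>_eq)
qed

end

text \<open>Opposite angles give the two points of equal potential. In this form the energy enters
  only through the argument of \<open>\<phi>\<close>.\<close>

lemma (in orbit) k_symmetric_sum:
  assumes "0 < \<theta>" "\<theta> < pi / 2"
  shows "k \<theta> + k (- \<theta>) = (cos \<theta> / sin \<theta>) powr \<alpha> / a * \<phi> (r * sin \<theta>)"
proof -
  have "0 < cos \<theta>" "0 < sin \<theta>" using assms by (auto simp: cos_gt_zero sin_gt_zero)
  then have "(cos \<theta> / sin \<theta>) powr \<alpha> * (r * sin \<theta>) powr \<alpha> = (r * cos \<theta>) powr \<alpha>"
    using r_pos by (simp add: mult.commute flip: powr_mult)
  moreover have "k \<theta> + k (- \<theta>) = (r * cos \<theta>) powr \<alpha> / a * (1 / H (g (r * sin \<theta>)) + 1 / H (g (- (r * sin \<theta>))))"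
    using r_pos \<open>0 < cos \<theta>\<close> by (simp add: k_def \<gamma>_def \<alpha>_def[symmetric] distrib_left)
  ultimately show ?thesis by (simp add: \<phi>_def flip: mult.assoc)
qed

section \<open>Monotonicity of the period and its limits\<close>

context plaplace
begin

lemma orbitI: "0 < E \<Longrightarrow> E < Emax \<Longrightarrow> orbit p q E"
  by unfold_locales

lemma period_strict_mono:
  assumes "0 < E" "E < E'" "E' < Emax"
  shows "period p q E < period p q E'"
proof -
  interpret A: orbit p q E by (rule orbitI) (use assms in auto)
  interpret B: orbit p q E' by (rule orbitI) (use assms in auto)
  have r: "A.r < B.r" using assms by (simp add: A.r_def B.r_def)
  \<comment> \<open>The orbits are compared at equal angles: \<open>D 0 = 0\<close>, and by
    \<open>P_half\<close> the value at \<open>pi / 2\<close> is half the difference of the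
    periods.\<close>
  define D where "D \<theta> = (B.K \<theta> - B.K (- \<theta>)) - (A.K \<theta> - A.K (- \<theta>))" for \<theta>
  have D: "(D has_real_derivative (B.k \<theta> + B.k (- \<theta>)) - (A.k \<theta> + A.k (- \<theta>))) (at \<theta>)" for \<theta>
    unfolding D_def
    by (auto intro!: derivative_eq_intros A.DERIV_K B.DERIV_K DERIV_chain2[OF A.DERIV_K] DERIV_chain2[OF B.DERIV_K])
  have "D 0 < D (pi / 2)"
  proof (rule DERIV_pos_imp_increasing_open[where f = D and a = 0 and b = "pi / 2"])
    fix \<theta> :: real assume \<theta>: "0 < \<theta>" "\<theta> < pi / 2"
    then have cs: "0 < cos \<theta>" "0 < sin \<theta>" by (auto simp: cos_gt_zero sin_gt_zero)
    have "\<phi> (A.r * sin \<theta>) < \<phi> (B.r * sin \<theta>)"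
    proof (rule \<phi>_strict_mono)
      show "0 < A.r * sin \<theta>" "A.r * sin \<theta> < B.r * sin \<theta>" using r A.r_pos cs by auto
      show "B.r * sin \<theta> < sqrt Emax" using B.in_chart[of \<theta>] by (simp add: abs_less_iff)
    qed
    moreover have "0 < (cos \<theta> / sin \<theta>) powr \<alpha> / a" using cs a_pos by simp
    ultimately have "0 < (B.k \<theta> + B.k (- \<theta>)) - (A.k \<theta> + A.k (- \<theta>))"
      unfolding A.k_symmetric_sum[OF \<theta>] B.k_symmetric_sum[OF \<theta>] diff_gt_0_iff_gt
      by (rule mult_strict_left_mono)
    then show "\<exists>d. (D has_real_derivative d) (at \<theta>) \<and> 0 < d" using D by blast
  next
    show "continuous_on {0..pi / 2} D"
      by (intro continuous_at_imp_continuous_on ballI DERIV_isCont[OF D])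
  qed simp
  then show ?thesis
    by (simp add: A.period_eq B.period_eq A.P_half B.P_half D_def)
qed

text \<open>Orbits of energy below \<open>Emax / 4\<close> stay where \<open>H \<ge> L > 0\<close>.
  Hence \<open>k \<le> r powr \<alpha> / (a * L)\<close>, which vanishes with the energy because
  \<open>\<alpha> > 0\<close>.\<close>

lemma period_tendsto_0: "(period p q \<longlongrightarrow> 0) (at_right 0)"
proof -
  define \<rho> where "\<rho> = sqrt (Emax / 4)"
  have "Emax / 4 < Emax" using Emax_pos by simp
  then have \<rho>: "0 < \<rho>" "\<rho> < sqrt Emax" using Emax_pos by (simp_all add: \<rho>_def del: real_sqrt_divide)
  then have dom: "\<bar>u\<bar> < sqrt Emax" if "u \<in> {- \<rho>..\<rho>}" for u
    using that by auto
  have "continuous_on {- \<rho>..\<rho>} (\<lambda>u. H (g u))"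
    using isCont_o2[OF isCont_g isCont_H[OF g_pos]] dom
    by (intro continuous_at_imp_continuous_on ballI) auto
  then obtain u0 where u0: "u0 \<in> {- \<rho>..\<rho>}" "\<And>u. u \<in> {- \<rho>..\<rho>} \<Longrightarrow> H (g u0) \<le> H (g u)"
    using continuous_attains_inf[of "{- \<rho>..\<rho>}" "\<lambda>u. H (g u)"] \<rho> by auto
  define L where "L = H (g u0)"
  have L: "0 < L" using H_pos[OF g_pos[OF dom[OF u0(1)]]] by (simp add: L_def)
  have bound: "0 \<le> period p q E \<and> period p q E \<le> 2 * pi / (a * L) * sqrt E powr \<alpha>"
    if "0 < E" "E < Emax / 4" for E
  proof -
    interpret orbit p q E by (rule orbitI) (use that Emax_pos in auto)
    have "r \<le> \<rho>" using that by (simp add: r_def \<rho>_def del: real_sqrt_divide)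
    define C where "C = r powr \<alpha> / (a * L)"
    have k: "k \<theta> \<le> C" for \<theta>
    proof -
      have "\<bar>r * sin \<theta>\<bar> \<le> r" using r_pos by (simp add: abs_mult)
      then have "L \<le> H (\<gamma> \<theta>)"
        using u0(2)[of "r * sin \<theta>"] \<open>r \<le> \<rho>\<close> unfolding L_def \<gamma>_def by (auto simp: abs_le_iff)
      moreover have "\<bar>r * cos \<theta>\<bar> powr \<alpha> \<le> r powr \<alpha>"
        using r_pos \<alpha>_pos by (intro powr_mono2) (auto simp: abs_mult)
      ultimately show ?thesis
        unfolding k_def \<alpha>_def[symmetric] C_def using L a_pos by (intro frac_le mult_left_mono mult_pos_pos) auto
    qed
    have "C * (- (pi / 2)) - K (- (pi / 2)) \<le> C * (pi / 2) - K (pi / 2)"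
    proof (rule DERIV_nonneg_imp_nondecreasing[where f = "\<lambda>\<theta>. C * \<theta> - K \<theta>"])
      fix \<theta>
      have "((\<lambda>\<theta>. C * \<theta> - K \<theta>) has_real_derivative C - k \<theta>) (at \<theta>)"
        by (rule DERIV_diff[OF DERIV_cmult_Id DERIV_K])
      then show "\<exists>d. ((\<lambda>\<theta>. C * \<theta> - K \<theta>) has_real_derivative d) (at \<theta>) \<and> 0 \<le> d"
        using k[of \<theta>] by (intro exI[of _ "C - k \<theta>"]) simp
    qed simp
    then have "P \<le> 2 * pi * C" by (simp add: P_half algebra_simps)
    then show ?thesis using P_pos by (simp add: period_eq r_def C_def)
  qed
  have "((\<lambda>E. 2 * pi / (a * L) * sqrt E powr \<alpha>) \<longlongrightarrow> 2 * pi / (a * L) * sqrt 0 powr \<alpha>) (at_right 0)"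
    using \<alpha>_pos by (intro tendsto_intros tendsto_powr2) (auto simp: eventually_at_filter)
  then have lim: "((\<lambda>E. 2 * pi / (a * L) * sqrt E powr \<alpha>) \<longlongrightarrow> 0) (at_right 0)" by simp
  have ev: "eventually (\<lambda>E. E \<in> {0<..<Emax / 4}) (at_right 0)"
    using Emax_pos by (intro eventually_at_right_real) simp
  show ?thesis
  proof (rule tendsto_sandwich[OF _ _ tendsto_const lim])
    show "eventually (\<lambda>E. 0 \<le> period p q E) (at_right 0)"
      using ev by eventually_elim (use bound in auto)
    show "eventually (\<lambda>E. period p q E \<le> 2 * pi / (a * L) * sqrt E powr \<alpha>) (at_right 0)"
      using ev by eventually_elim (use bound in auto)
  qed
qed

text \<open>Since \<open>E - V w \<le> w\<^sup>p / p\<close> for \<open>E < Emax\<close>, the logarithm of a solution has bounded slope, and half a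
  period is spent climbing from the minimum, which tends to \<open>0\<close>, to above \<open>1\<close>.\<close>

lemma period_ge_ln:
  assumes "0 < E" "E < Emax"
  shows "- (2 / a) * ln (g (- sqrt E)) \<le> period p q E"
proof -
  interpret orbit p q E by (rule orbitI) (use assms in auto)
  \<comment> \<open>On the climbing half turn, \<open>a\<close> times the elapsed time is at least
    the growth of the logarithm.\<close>
  have "a * K (- (pi / 2)) - ln (\<gamma> (- (pi / 2))) \<le> a * K (pi / 2) - ln (\<gamma> (pi / 2))"
  proof (rule DERIV_nonneg_imp_nondecreasing[where f = "\<lambda>\<theta>. a * K \<theta> - ln (\<gamma> \<theta>)"])
    fix \<theta> assume \<theta>: "- (pi / 2) \<le> \<theta>" "\<theta> \<le> pi / 2"
    let ?d = "a * k \<theta> - r * cos \<theta> / H (\<gamma> \<theta>) / \<gamma> \<theta>"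
    have "((\<lambda>\<theta>. a * K \<theta> - ln (\<gamma> \<theta>)) has_real_derivative ?d) (at \<theta>)"
      using \<gamma>_pos[of \<theta>] by (auto intro!: derivative_eq_intros DERIV_K DERIV_\<gamma>)
    moreover have "0 \<le> ?d"
    proof (cases "cos \<theta> = 0")
      case True
      then show ?thesis using k_nonneg a_pos by simp
    next
      case False
      then have c: "0 < r * cos \<theta>" using \<theta> r_pos cos_ge_zero[of \<theta>] by (simp add: less_le)
      have k0: "0 < k \<theta>" using False k_pos_iff by simp
      have "(r * cos \<theta>)\<^sup>2 + (r * sin \<theta>)\<^sup>2 = E"
        by (simp add: power_mult_distrib r_sq flip: distrib_left)
      moreover have "(r * sin \<theta>)\<^sup>2 = V (\<gamma> \<theta>)" by (metis h_\<gamma> h_sq \<gamma>_pos)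
      moreover have "Emax - \<gamma> \<theta> powr p / p \<le> V (\<gamma> \<theta>)"
        using p pq by (simp add: V_pos_arg \<gamma>_pos)
      ultimately have "(r * cos \<theta>)\<^sup>2 \<le> \<gamma> \<theta> powr p / p" using E_less by linarith
      \<comment> \<open>Dropping the factor \<open>1 / p < 1\<close> leaves a velocity of at most
        \<open>a * \<gamma> \<theta>\<close>.\<close>
      also have "\<dots> \<le> \<gamma> \<theta> powr p / 1" using p by (intro divide_left_mono) auto
      finally have "((r * cos \<theta>)\<^sup>2) powr (1 / p) \<le> (\<gamma> \<theta> powr p) powr (1 / p)"
        using p by (intro powr_mono2) auto
      moreover have "((r * cos \<theta>)\<^sup>2) powr (1 / p) = (r * cos \<theta>) powr (2 / p)"
        using c powr_powr[of "r * cos \<theta>" 2 "1 / p"] by simp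
      moreover have "(\<gamma> \<theta> powr p) powr (1 / p) = \<gamma> \<theta>"
        using p \<gamma>_pos[of \<theta>] by (simp add: powr_powr)
      ultimately have le: "spow (2 / p) (r * cos \<theta>) \<le> \<gamma> \<theta>" using c by (simp add: spow_pos)
      have "r * cos \<theta> / H (\<gamma> \<theta>) = a * k \<theta> * spow (2 / p) (r * cos \<theta>)"
      proof -
        have "r * cos \<theta> / H (\<gamma> \<theta>) = (r * cos \<theta> / H (\<gamma> \<theta>) / k \<theta>) * k \<theta>" using k0 by simp
        also have "\<dots> = a * spow (2 / p) (r * cos \<theta>) * k \<theta>" by (simp only: speed_identity[OF False])
        finally show ?thesis by (simp only: mult_ac)
      qed
      also have "\<dots> \<le> a * k \<theta> * \<gamma> \<theta>" using le a_pos k0 by (intro mult_left_mono) auto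
      finally have "r * cos \<theta> / H (\<gamma> \<theta>) / \<gamma> \<theta> \<le> a * k \<theta>"
        by (simp only: pos_divide_le_eq[OF \<gamma>_pos])
      then show ?thesis by simp
    qed
    ultimately show "\<exists>d. ((\<lambda>\<theta>. a * K \<theta> - ln (\<gamma> \<theta>)) has_real_derivative d) (at \<theta>) \<and> 0 \<le> d" by blast
  qed simp
  \<comment> \<open>The maximum of the orbit exceeds \<open>1\<close>, so its logarithm can be
    discarded.\<close>
  moreover have "0 \<le> ln (\<gamma> (pi / 2))"
    using g_less_iff[of 0 r] r_pos r_less Emax_pos by (simp add: \<gamma>_def g_0)
  moreover have "\<gamma> (- (pi / 2)) = g (- sqrt E)" by (simp add: \<gamma>_def r_def)
  ultimately have "- ln (g (- sqrt E)) \<le> a * (K (pi / 2) - K (- (pi / 2)))"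
    by (simp add: algebra_simps)
  also have "\<dots> = a / 2 * P" by (simp add: P_half)
  finally show ?thesis using a_pos by (simp add: period_eq field_simps)
qed

lemma period_at_top: "filterlim (period p q) at_top (at_left Emax)"
  unfolding filterlim_at_top_gt[where c = 0]
proof (intro allI impI)
  fix Z :: real assume Z: "0 < Z"
  \<comment> \<open>Chosen so that \<open>- (2 / a) * ln \<epsilon> = Z\<close>; for
    \<open>E > V \<epsilon>\<close> the minimum of the orbit lies below
    \<open>\<epsilon>\<close>.\<close>
  define \<epsilon> where "\<epsilon> = exp (- a * Z / 2)"
  have \<epsilon>: "0 < \<epsilon>" "\<epsilon> < 1" using Z a_pos by (simp_all add: \<epsilon>_def)
  have V\<epsilon>: "V \<epsilon> < Emax" "0 < V \<epsilon>" using V_less_Emax[of \<epsilon>] V_pos[of \<epsilon>] \<epsilon> by auto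
  have "eventually (\<lambda>E. E \<in> {V \<epsilon><..<Emax}) (at_left Emax)"
    using V\<epsilon> by (intro eventually_at_left_real)
  then show "eventually (\<lambda>E. Z \<le> period p q E) (at_left Emax)"
  proof eventually_elim
    case (elim E)
    then have E: "V \<epsilon> < E" "0 < E" "E < Emax" using V\<epsilon> by auto
    then have dom: "\<bar>- sqrt E\<bar> < sqrt Emax" by simp
    have "h (g (- sqrt E)) < h \<epsilon>" using E \<epsilon> by (simp only: h_g[OF dom]) (simp add: h_def)
    then have "g (- sqrt E) < \<epsilon>" using h_less_iff g_pos[OF dom] \<epsilon> by blast
    then have "ln (g (- sqrt E)) < - a * Z / 2"
      using g_pos[OF dom] \<epsilon> by (metis \<epsilon>_def ln_exp ln_less_cancel_iff)
    then have "Z \<le> - (2 / a) * ln (g (- sqrt E))" using a_pos by (simp add: field_simps)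
    then show ?case using period_ge_ln[of E] E by linarith
  qed
qed

end

theorem theorem1p3:
  fixes p q :: real
  assumes "2 < p" and "p < q"
  shows "strict_mono_on {0<..<max_energy p q} (period p q) \<and>
         (period p q \<longlongrightarrow> 0) (at_right 0) \<and>
         filterlim (period p q) at_top (at_left (max_energy p q))"
proof -
  interpret plaplace p q by unfold_locales (fact assms)+
  show ?thesis
    using period_strict_mono period_tendsto_0 period_at_top by (auto intro!: strict_mono_onI)
qed

end
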